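(* Let $N\ge2$, $m\ge1$, and let $H\in PF_{2m}$ be an element of the parafermion algebra, written as $$-H=\sum_{I,I'}J_I^{I'}\,\Theta(C_I)\otimes_t C_{I'},\qquad J_I^{I'}\in\mathbb{C},$$ where $I,I'$ range over $\{0,\dots,N-1\}^m$. Suppose $H$ is reflection invariant, $\Theta(H)=H$ (equivalently the matrix $J=(J_I^{I'})$ is Hermitian), and $H$ has grading $0$. Let $J_0$ be the submatrix of $J$ indexed by the pairs $(I,I')$ with both $I\neq0$ and $I'\neq0$. Then $H$ has reflection positivity, i.e. $$\mathrm{tr}\bigl(e^{-\beta H}(\Theta(x)\otimes_t x)\bigr)\ge0\quad\text{for all }x\in PF_m\text{ and all }\beta\ge0,$$ if and only if $J_0\ge0$ (positive semi-definite).
   Context: Let $q=e^{2\pi i/N}$ and let $\zeta$ be a square root of $q$ with $\zeta^{N^2}=1$. $PF_n$ is the complex algebra generated by $c_1,\dots,c_n$ with $c_i^N=1$ and $c_ic_j=q\,c_jc_i$ for $i<j$, with $*$-structure $c_i^*=c_i^{-1}$. It has basis $C_I=c_1^{i_1}\cdots c_n^{i_n}$, $I=(i_1,\dots,i_n)\in\{0,\dots,N-1\}^n$ ("empty" $I$ means $I=0$, $C_0=1$), is $\mathbb{Z}_N$-graded with each $c_i$ of grading $1$, and has tracial state $\mathrm{tr}(1)=1$, $\mathrm{tr}(C_I)=0$ for $I\ne0$. The double: $PF_m$ is identified with $A_-=\langle c_1,\dots,c_m\rangle\subset PF_{2m}$ (elements $y\otimes I_m$) and, via $\sigma:c_i\mapsto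 c_{m+i}$, with $A_+=\langle c_{m+1},\dots,c_{2m}\rangle\subset PF_{2m}$ (elements $I_m\otimes x$). The graded tensor product is $y\otimes_+x=y\,\sigma(x)\in PF_{2m}$ for $x,y\in PF_m$. The horizontal reflection $\Theta$ on $PF_n$ is the anti-linear homomorphism with $\Theta(c_j)=c_{n+1-j}^{-1}$, i.e. the anti-linear extension of $\Theta(c_1^{i_1}c_2^{i_2}\cdots c_n^{i_n})=c_n^{-i_1}c_{n-1}^{-i_2}\cdots c_1^{-i_n}$. (It is used with $n=m$ in $\Theta(C_I)$, $\Theta(x)$, and with $n=2m$ in $\Theta(H)$.) Twisted tensor product: for homogeneous $x,y\in PF_m$ with gradings represented by $i,j\in\{0,\dots,N-1\}$, $\Theta(x)\otimes_t y=\zeta^{ij}\,\Theta(x)\otimes_+y$; for equal gradings this is $\zeta^{i^2}\Theta(x)\otimes_+ y$. It is extended to all $x,y$ anti-linearly in $x$ and linearly in $y$. (The trace in the reflection-positivity condition does not depend on the choice of representatives of the gradings.) *)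

theory Defs
  imports
    Complex_Main
    "HOL-Library.Function_Algebras"
    "HOL-Library.Nonpos_Ints"
    "HOL-Algebra.Ring"
begin

section \<open>The parafermion algebra\<close>

definition pf_q :: "nat \<Rightarrow> complex" where
  "pf_q N = exp (2 * of_real pi * \<i> / of_nat N)"

text \<open>The index set $\{0,\dots,N-1\}^n$. The list entry at position $k$ (counted from 0) is the
  exponent of $c_{k+1}$.\<close>

definition pf_index :: "nat \<Rightarrow> nat \<Rightarrow> nat list set" where
  "pf_index N n = {I. length I = n \<and> set I \<subseteq> {..<N}}"

text \<open>An element $\sum_I x_I C_I$ of $PF_n$ is represented by its coefficient function
  $I \mapsto x_I$. Sums of elements are pointwise (\<open>Function_Algebras\<close>); the product of $PF_n$
  is \<open>pf_mult\<close> and \<^emph>\<open>not\<close> the pointwise product of functions.\<close>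

type_synonym pf = "nat list \<Rightarrow> complex"

definition pf_scale :: "complex \<Rightarrow> pf \<Rightarrow> pf"  (infixr \<open>\<cdot>\<^sub>c\<close> 75) where
  "a \<cdot>\<^sub>c x = (\<lambda>I. a * x I)"

definition pf_delta :: "nat list \<Rightarrow> pf" where
  "pf_delta I = (\<lambda>K. if K = I then 1 else 0)"

definition pf_index_add :: "nat \<Rightarrow> nat list \<Rightarrow> nat list \<Rightarrow> nat list" where
  "pf_index_add N I J = map (\<lambda>k. (I ! k + J ! k) mod N) [0..<length I]"

text \<open>Reordering $c_1^{i_1}\cdots c_n^{i_n}\,c_1^{j_1}\cdots c_n^{j_n}$ moves $c_l^{j_l}$ to the left
  past $c_k^{i_k}$ for all $l<k$; as $c_kc_l=q^{-1}c_lc_k$, this produces the phase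
  $\prod_{l<k} q^{-i_kj_l}$.\<close>

definition pf_phase :: "nat \<Rightarrow> nat list \<Rightarrow> nat list \<Rightarrow> complex" where
  "pf_phase N I J = inverse (pf_q N) ^ (\<Sum>k<length I. \<Sum>l<k. I ! k * J ! l)"

definition pf_mult :: "nat \<Rightarrow> nat \<Rightarrow> pf \<Rightarrow> pf \<Rightarrow> pf" where
  "pf_mult N n x y = (\<Sum>I\<in>pf_index N n. \<Sum>J\<in>pf_index N n.
     (x I * y J * pf_phase N I J) \<cdot>\<^sub>c pf_delta (pf_index_add N I J))"

definition PF :: "nat \<Rightarrow> nat \<Rightarrow> pf ring" where
  "PF N n = \<lparr>carrier = {x. \<forall>I. I \<notin> pf_index N n \<longrightarrow> x I = 0},
     mult = pf_mult N n, one = pf_delta (replicate n 0), zero = 0, add = (+)\<rparr>"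

text \<open>The generators $c_1,\dots,c_n$; the first index is 1.\<close>

definition pf_gen :: "nat \<Rightarrow> nat \<Rightarrow> pf" where
  "pf_gen n k = pf_delta ((replicate n 0)[k - 1 := 1])"

text \<open>$C_I=c_1^{i_1}\cdots c_n^{i_n}$\<close>

definition pf_C :: "nat \<Rightarrow> nat \<Rightarrow> nat list \<Rightarrow> pf" where
  "pf_C N n I = foldr (\<lambda>k y. pf_gen n k [^]\<^bsub>PF N n\<^esub> (I ! (k - 1)) \<otimes>\<^bsub>PF N n\<^esub> y)
     [1..<n + 1] \<one>\<^bsub>PF N n\<^esub>"

definition pf_tr :: "nat \<Rightarrow> pf \<Rightarrow> complex" where
  "pf_tr n x = x (replicate n 0)"

text \<open>The component of $x$ of grading $d \in \{0,\dots,N-1\}$.\<close>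

definition pf_component :: "nat \<Rightarrow> nat \<Rightarrow> pf \<Rightarrow> pf" where
  "pf_component N d x = (\<lambda>I. if sum_list I mod N = d then x I else 0)"

definition pf_has_grading :: "nat \<Rightarrow> nat \<Rightarrow> nat \<Rightarrow> pf \<Rightarrow> bool" where
  "pf_has_grading N n d x \<longleftrightarrow>
     x \<in> carrier (PF N n) \<and> (\<forall>I. x I \<noteq> 0 \<longrightarrow> sum_list I mod N = d mod N)"

text \<open>The exponential series, summed coefficientwise (it converges, see \<open>pf_exp_sums\<close>).\<close>

definition pf_exp :: "nat \<Rightarrow> nat \<Rightarrow> pf \<Rightarrow> pf" where
  "pf_exp N n x = (\<lambda>I. \<Sum>k. (x [^]\<^bsub>PF N n\<^esub> (k::nat)) I / fact k)"


section \<open>Reflection, tensor products, reflection positivity\<close>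

text \<open>The anti-linear extension of
  $\Theta(c_1^{i_1}\cdots c_n^{i_n})=c_n^{-i_1}c_{n-1}^{-i_2}\cdots c_1^{-i_n}$.\<close>

definition pf_Theta_C :: "nat \<Rightarrow> nat \<Rightarrow> nat list \<Rightarrow> pf" where
  "pf_Theta_C N n I =
     foldr (\<lambda>k y. (inv\<^bsub>PF N n\<^esub> (pf_gen n (n + 1 - k))) [^]\<^bsub>PF N n\<^esub> (I ! (k - 1)) \<otimes>\<^bsub>PF N n\<^esub> y)
       [1..<n + 1] \<one>\<^bsub>PF N n\<^esub>"

definition pf_Theta :: "nat \<Rightarrow> nat \<Rightarrow> pf \<Rightarrow> pf" where
  "pf_Theta N n x = (\<Sum>I\<in>pf_index N n. cnj (x I) \<cdot>\<^sub>c pf_Theta_C N n I)"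

text \<open>The identifications of $PF_m$ with $A_-$ ($c_i \mapsto c_i$) and with $A_+$
  ($\sigma: c_i\mapsto c_{m+i}$) inside $PF_{2m}$, given on the bases.\<close>

definition pf_minus :: "nat \<Rightarrow> nat \<Rightarrow> pf \<Rightarrow> pf" where
  "pf_minus N m y = (\<Sum>I\<in>pf_index N m. y I \<cdot>\<^sub>c pf_C N (2 * m) (I @ replicate m 0))"

definition pf_sigma :: "nat \<Rightarrow> nat \<Rightarrow> pf \<Rightarrow> pf" where
  "pf_sigma N m x = (\<Sum>I\<in>pf_index N m. x I \<cdot>\<^sub>c pf_C N (2 * m) (replicate m 0 @ I))"

definition pf_tensor :: "nat \<Rightarrow> nat \<Rightarrow> pf \<Rightarrow> pf \<Rightarrow> pf" where
  "pf_tensor N m y x = pf_minus N m y \<otimes>\<^bsub>PF N (2 * m)\<^esub> pf_sigma N m x"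

text \<open>\<open>pf_Theta_twist \<zeta> N m x y\<close> is $\Theta(x)\otimes_t y$: for homogeneous $x,y$ of gradings
  $i,j\in\{0,\dots,N-1\}$ it is $\zeta^{ij}\,\Theta(x)\otimes_+y$.\<close>

definition pf_Theta_twist :: "complex \<Rightarrow> nat \<Rightarrow> nat \<Rightarrow> pf \<Rightarrow> pf \<Rightarrow> pf" where
  "pf_Theta_twist \<zeta> N m x y = (\<Sum>i<N. \<Sum>j<N.
     \<zeta> ^ (i * j) \<cdot>\<^sub>c pf_tensor N m (pf_Theta N m (pf_component N i x)) (pf_component N j y))"

definition pf_reflection_positive :: "complex \<Rightarrow> nat \<Rightarrow> nat \<Rightarrow> pf \<Rightarrow> bool" where
  "pf_reflection_positive \<zeta> N m H \<longleftrightarrow>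
     (\<forall>x\<in>carrier (PF N m). \<forall>\<beta>::real. \<beta> \<ge> 0 \<longrightarrow>
        pf_tr (2 * m) (pf_exp N (2 * m) (of_real (- \<beta>) \<cdot>\<^sub>c H) \<otimes>\<^bsub>PF N (2 * m)\<^esub>
          pf_Theta_twist \<zeta> N m x x) \<in> \<real>\<^sub>\<ge>\<^sub>0)"

definition psd_on :: "'a set \<Rightarrow> ('a \<Rightarrow> 'a \<Rightarrow> complex) \<Rightarrow> bool" where
  "psd_on S A \<longleftrightarrow> (\<forall>v. (\<Sum>i\<in>S. \<Sum>j\<in>S. cnj (v i) * A i j * v j) \<in> \<real>\<^sub>\<ge>\<^sub>0)"


section \<open>Ring structure, defining relations and the basis $C_I$\<close>

lemma finite_pf_index [simp, intro]: "finite (pf_index N n)"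
proof -
  have "pf_index N n = {I. set I \<subseteq> {..<N} \<and> length I = n}" by (auto simp: pf_index_def)
  then show ?thesis by (simp add: finite_lists_length_eq)
qed

lemma pf_sum_apply: "(sum f A :: pf) K = (\<Sum>i\<in>A. f i K)"
  by (induction A rule: infinite_finite_induct) auto

lemma pf_index_nth: "I \<in> pf_index N n \<Longrightarrow> k < n \<Longrightarrow> I ! k < N"
  by (auto simp: pf_index_def subset_iff)

lemma pf_index_length: "I \<in> pf_index N n \<Longrightarrow> length I = n"
  by (auto simp: pf_index_def)

lemma pf_index_add_closed:
  "N > 0 \<Longrightarrow> I \<in> pf_index N n \<Longrightarrow> pf_index_add N I J \<in> pf_index N n"
  by (auto simp: pf_index_def pf_index_add_def)

lemma pf_index_zero: "N > 0 \<Longrightarrow> replicate n 0 \<in> pf_index N n"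
  by (auto simp: pf_index_def)

lemma pf_index_add_zero:
  "I \<in> pf_index N n \<Longrightarrow> pf_index_add N I (replicate n 0) = I"
  "I \<in> pf_index N n \<Longrightarrow> pf_index_add N (replicate n 0) I = I"
  by (auto simp: pf_index_add_def pf_index_length pf_index_nth intro!: nth_equalityI)

lemma pf_index_add_assoc:
  assumes "I \<in> pf_index N n" "J \<in> pf_index N n" "K \<in> pf_index N n"
  shows "pf_index_add N (pf_index_add N I J) K = pf_index_add N I (pf_index_add N J K)"
  using assms
  by (auto simp: pf_index_add_def pf_index_length mod_simps add.assoc intro!: nth_equalityI)

lemma pf_q_power: "N > 0 \<Longrightarrow> pf_q N ^ N = 1"
  by (simp add: pf_q_def flip: exp_of_nat_mult)

lemma pf_q_nz [simp]: "pf_q N \<noteq> 0"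
  by (simp add: pf_q_def)

lemma pf_phase_eq:
  "pf_phase N I J = (\<Prod>k<length I. \<Prod>l<k. inverse (pf_q N) ^ (I ! k * J ! l))"
  by (simp add: pf_phase_def power_sum)

lemma pf_q_mod:
  assumes "N > 0" shows "inverse (pf_q N) ^ (a mod N) = inverse (pf_q N) ^ a"
proof -
  have "inverse (pf_q N) ^ a = inverse (pf_q N) ^ (N * (a div N) + a mod N)" by simp
  also have "\<dots> = inverse (pf_q N) ^ (a mod N)"
    unfolding power_add power_mult using pf_q_power[OF assms] by (simp add: power_inverse)
  finally show ?thesis by simp
qed

lemma pf_q_mod_mult:
  assumes "N > 0"
  shows "inverse (pf_q N) ^ (a mod N * b) = inverse (pf_q N) ^ (a * b)"
    and "inverse (pf_q N) ^ (b * (a mod N)) = inverse (pf_q N) ^ (b * a)"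
proof -
  have "inverse (pf_q N) ^ (a mod N * b) = inverse (pf_q N) ^ ((a mod N * b) mod N)"
    using pf_q_mod[OF assms] by simp
  also have "\<dots> = inverse (pf_q N) ^ (a * b)"
    using pf_q_mod[OF assms, of "a * b"] by (simp add: mod_simps)
  finally show "inverse (pf_q N) ^ (a mod N * b) = inverse (pf_q N) ^ (a * b)" .
  then show "inverse (pf_q N) ^ (b * (a mod N)) = inverse (pf_q N) ^ (b * a)"
    by (simp add: mult.commute)
qed

lemma pf_phase_add:
  assumes "N > 0" "I \<in> pf_index N n" "J \<in> pf_index N n" "K \<in> pf_index N n"
  shows "pf_phase N (pf_index_add N I J) K = pf_phase N I K * pf_phase N J K"
    and "pf_phase N I (pf_index_add N J K) = pf_phase N I J * pf_phase N I K"
  using assms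
  by (simp_all add: pf_phase_eq pf_index_length pf_index_add_def pf_q_mod_mult
      distrib_left distrib_right power_add prod.distrib)

lemma pf_phase_zero [simp]:
  "pf_phase N (replicate n 0) J = 1" "length I = n \<Longrightarrow> pf_phase N I (replicate n 0) = 1"
  by (simp_all add: pf_phase_eq)

lemma pf_mult_apply:
  "pf_mult N n x y K = (\<Sum>I\<in>pf_index N n. \<Sum>J\<in>pf_index N n.
     if K = pf_index_add N I J then x I * y J * pf_phase N I J else 0)"
  by (auto simp: pf_mult_def pf_sum_apply pf_scale_def pf_delta_def intro!: sum.cong)

lemma pf_mult_closed: "N > 0 \<Longrightarrow> K \<notin> pf_index N n \<Longrightarrow> pf_mult N n x y K = 0"
  unfolding pf_mult_apply by (intro sum.neutral ballI) (auto simp: pf_index_add_closed)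

lemma pf_delta_mult_left:
  assumes "I \<in> pf_index N n"
  shows "pf_mult N n (pf_delta I) y K = (\<Sum>J\<in>pf_index N n.
     if K = pf_index_add N I J then y J * pf_phase N I J else 0)"
proof -
  have "pf_mult N n (pf_delta I) y K = (\<Sum>I'\<in>pf_index N n. if I' = I then (\<Sum>J\<in>pf_index N n.
     if K = pf_index_add N I J then y J * pf_phase N I J else 0) else 0)"
    unfolding pf_mult_apply
    by (intro sum.cong refl) (auto simp: pf_delta_def intro!: sum.neutral sum.cong)
  then show ?thesis using assms by simp
qed

lemma pf_delta_mult:
  assumes "I \<in> pf_index N n" "J \<in> pf_index N n"
  shows "pf_mult N n (pf_delta I) (pf_delta J) = pf_phase N I J \<cdot>\<^sub>c pf_delta (pf_index_add N I J)"
proof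
  fix K
  have "pf_mult N n (pf_delta I) (pf_delta J) K =
    (\<Sum>J'\<in>pf_index N n. if J' = J then
      (if K = pf_index_add N I J then pf_phase N I J else 0) else 0)"
    unfolding pf_delta_mult_left[OF assms(1)] by (intro sum.cong) (auto simp: pf_delta_def)
  then show "pf_mult N n (pf_delta I) (pf_delta J) K =
      (pf_phase N I J \<cdot>\<^sub>c pf_delta (pf_index_add N I J)) K"
    using assms by (simp add: pf_scale_def pf_delta_def)
qed

lemma pf_mult_one:
  assumes "N > 0" "x \<in> carrier (PF N n)"
  shows "pf_mult N n (pf_delta (replicate n 0)) x = x"
    and "pf_mult N n x (pf_delta (replicate n 0)) = x"
proof -
  have x: "x K = 0" if "K \<notin> pf_index N n" for K using assms that by (auto simp: PF_def)
  have "pf_mult N n (pf_delta (replicate n 0)) x K = x K" for K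
  proof -
    have "pf_mult N n (pf_delta (replicate n 0)) x K =
        (\<Sum>J\<in>pf_index N n. if J = K then x K else 0)"
      unfolding pf_delta_mult_left[OF pf_index_zero[OF assms(1)]]
      by (intro sum.cong) (auto simp: pf_index_add_zero)
    then show ?thesis using x by auto
  qed
  then show "pf_mult N n (pf_delta (replicate n 0)) x = x" by blast
  have "pf_mult N n x (pf_delta (replicate n 0)) K = x K" for K
  proof -
    have "pf_mult N n x (pf_delta (replicate n 0)) K =
       (\<Sum>I\<in>pf_index N n. \<Sum>J\<in>pf_index N n. if J = replicate n 0 then (if I = K then x K else 0) else 0)"
      unfolding pf_mult_apply
      by (intro sum.cong refl) (auto simp: pf_delta_def pf_index_add_zero pf_index_length)
    then show ?thesis using x pf_index_zero[OF assms(1), of n] by auto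
  qed
  then show "pf_mult N n x (pf_delta (replicate n 0)) = x" by blast
qed

lemma pf_mult_assoc:
  assumes "N > 0"
  shows "pf_mult N n (pf_mult N n x y) z = pf_mult N n x (pf_mult N n y z)"
proof
  fix L
  let ?X = "pf_index N n" and ?a = "pf_index_add N" and ?w = "pf_phase N"
  define T where "T I J K = (if L = ?a (?a I J) K
     then x I * y J * z K * (?w I J * ?w I K * ?w J K) else 0)" for I J K
  have "pf_mult N n (pf_mult N n x y) z L = (\<Sum>A\<in>?X. \<Sum>K\<in>?X. \<Sum>I\<in>?X. \<Sum>J\<in>?X.
      if A = ?a I J then (if L = ?a A K then x I * y J * ?w I J * z K * ?w A K else 0) else 0)"
    unfolding pf_mult_apply[of _ _ _ _ L]
    by (intro sum.cong refl) (auto simp: pf_mult_apply sum_distrib_right intro!: sum.neutral sum.cong)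
  also have "\<dots> = (\<Sum>K\<in>?X. \<Sum>A\<in>?X. \<Sum>I\<in>?X. \<Sum>J\<in>?X.
      if A = ?a I J then (if L = ?a A K then x I * y J * ?w I J * z K * ?w A K else 0) else 0)"
    by (rule sum.swap)
  also have "\<dots> = (\<Sum>K\<in>?X. \<Sum>I\<in>?X. \<Sum>A\<in>?X. \<Sum>J\<in>?X.
      if A = ?a I J then (if L = ?a A K then x I * y J * ?w I J * z K * ?w A K else 0) else 0)"
    by (intro sum.cong refl sum.swap)
  also have "\<dots> = (\<Sum>K\<in>?X. \<Sum>I\<in>?X. \<Sum>J\<in>?X. \<Sum>A\<in>?X.
      if A = ?a I J then (if L = ?a A K then x I * y J * ?w I J * z K * ?w A K else 0) else 0)"
    by (intro sum.cong refl sum.swap)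
  also have "\<dots> = (\<Sum>K\<in>?X. \<Sum>I\<in>?X. \<Sum>J\<in>?X. T I J K)"
    using assms by (intro sum.cong refl) (simp add: pf_index_add_closed T_def pf_phase_add[where n = n])
  also have "\<dots> = (\<Sum>I\<in>?X. \<Sum>K\<in>?X. \<Sum>J\<in>?X. T I J K)" by (rule sum.swap)
  also have "\<dots> = (\<Sum>I\<in>?X. \<Sum>J\<in>?X. \<Sum>K\<in>?X. T I J K)" by (intro sum.cong refl sum.swap)
  finally have l: "pf_mult N n (pf_mult N n x y) z L = (\<Sum>I\<in>?X. \<Sum>J\<in>?X. \<Sum>K\<in>?X. T I J K)" .
  have "pf_mult N n x (pf_mult N n y z) L = (\<Sum>I\<in>?X. \<Sum>A\<in>?X. \<Sum>J\<in>?X. \<Sum>K\<in>?X.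
      if A = ?a J K then (if L = ?a I A then x I * (y J * z K * ?w J K) * ?w I A else 0) else 0)"
    unfolding pf_mult_apply[of _ _ _ _ L]
    by (intro sum.cong refl)
      (auto simp: pf_mult_apply sum_distrib_right sum_distrib_left intro!: sum.neutral sum.cong)
  also have "\<dots> = (\<Sum>I\<in>?X. \<Sum>J\<in>?X. \<Sum>A\<in>?X. \<Sum>K\<in>?X.
      if A = ?a J K then (if L = ?a I A then x I * (y J * z K * ?w J K) * ?w I A else 0) else 0)"
    by (intro sum.cong refl sum.swap)
  also have "\<dots> = (\<Sum>I\<in>?X. \<Sum>J\<in>?X. \<Sum>K\<in>?X. \<Sum>A\<in>?X.
      if A = ?a J K then (if L = ?a I A then x I * (y J * z K * ?w J K) * ?w I A else 0) else 0)"
    by (intro sum.cong refl sum.swap)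
  also have "\<dots> = (\<Sum>I\<in>?X. \<Sum>J\<in>?X. \<Sum>K\<in>?X. T I J K)"
    using assms by (intro sum.cong refl)
      (simp add: pf_index_add_closed T_def pf_phase_add[where n = n] pf_index_add_assoc[where n = n])
  finally show "pf_mult N n (pf_mult N n x y) z L = pf_mult N n x (pf_mult N n y z) L"
    using l by simp
qed

lemma pf_mult_scale:
  "pf_mult N n (a \<cdot>\<^sub>c x) y = a \<cdot>\<^sub>c pf_mult N n x y"
  "pf_mult N n x (a \<cdot>\<^sub>c y) = a \<cdot>\<^sub>c pf_mult N n x y"
  by (auto simp: fun_eq_iff pf_mult_apply pf_scale_def sum_distrib_left mult_ac intro!: sum.cong)

lemma pf_mult_distrib:
  "pf_mult N n (x + x') y = pf_mult N n x y + pf_mult N n x' y"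
  "pf_mult N n y (x + x') = pf_mult N n y x + pf_mult N n y x'"
  by (auto simp: fun_eq_iff pf_mult_apply distrib_left distrib_right simp flip: sum.distrib
      intro!: sum.cong)

theorem PF_ring:
  assumes "N > 0"
  shows "ring (PF N n)"
proof (rule ringI)
  show "abelian_group (PF N n)"
  proof (rule abelian_groupI)
    fix x assume x: "x \<in> carrier (PF N n)"
    show "\<exists>y\<in>carrier (PF N n). y \<oplus>\<^bsub>PF N n\<^esub> x = \<zero>\<^bsub>PF N n\<^esub>"
      using x by (intro bexI[of _ "- x"]) (auto simp: PF_def fun_eq_iff)
  qed (auto simp: PF_def add.assoc add.commute)
  show "Group.monoid (PF N n)"
  proof (rule Group.monoidI)
    fix x y z
    show "(x \<otimes>\<^bsub>PF N n\<^esub> y) \<otimes>\<^bsub>PF N n\<^esub> z = x \<otimes>\<^bsub>PF N n\<^esub> (y \<otimes>\<^bsub>PF N n\<^esub> z)"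
      using pf_mult_assoc[OF assms] by (simp add: PF_def)
  qed (use assms pf_mult_one in \<open>auto simp: PF_def pf_mult_closed pf_delta_def pf_index_zero\<close>)
qed (auto simp: PF_def pf_mult_distrib)

definition pf_one_index :: "nat \<Rightarrow> nat \<Rightarrow> nat \<Rightarrow> nat list" where
  "pf_one_index n k i = (replicate n 0)[k := i]"

lemma pf_one_index: "i < N \<Longrightarrow> pf_one_index n k i \<in> pf_index N n"
  by (cases "k < n") (auto simp: pf_one_index_def pf_index_def set_update_subset_insert
      dest!: set_update_subset_insert[THEN subsetD])

lemma pf_one_index_nth: "l < n \<Longrightarrow> pf_one_index n k i ! l = (if l = k then i else 0)"
  by (cases "l = k") (auto simp: pf_one_index_def)

lemma length_pf_one_index [simp]: "length (pf_one_index n k i) = n"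
  by (simp add: pf_one_index_def)

lemma pf_one_index_zero [simp]: "pf_one_index n k 0 = replicate n 0"
  by (rule nth_equalityI) (auto simp: pf_one_index_nth)

lemma pf_phase_one_index:
  assumes "k < n"
  shows "pf_phase N (pf_one_index n k i) J = (\<Prod>l<k. inverse (pf_q N) ^ (i * J ! l))"
proof -
  have "pf_phase N (pf_one_index n k i) J =
      (\<Prod>k'<n. if k' = k then (\<Prod>l<k. inverse (pf_q N) ^ (i * J ! l)) else 1)"
    unfolding pf_phase_eq
    by (rule prod.cong) (auto simp: pf_one_index_def nth_list_update)
  then show ?thesis using assms by simp
qed

lemma pf_gen_pow:
  assumes "N \<ge> 2" "1 \<le> k" "k \<le> n"
  shows "pf_gen n k [^]\<^bsub>PF N n\<^esub> i = pf_delta (pf_one_index n (k - 1) (i mod N))"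
proof (induction i)
  case 0
  then show ?case using assms by (simp add: nat_pow_def PF_def)
next
  case (Suc i)
  have *: "pf_one_index n (k - 1) (i mod N) \<in> pf_index N n" "pf_one_index n (k - 1) 1 \<in> pf_index N n"
    using assms by (auto intro!: pf_one_index)
  have g: "pf_gen n k = pf_delta (pf_one_index n (k - 1) 1)"
    by (simp add: pf_gen_def pf_one_index_def)
  have a: "pf_index_add N (pf_one_index n (k - 1) (i mod N)) (pf_one_index n (k - 1) 1)
      = pf_one_index n (k - 1) (Suc i mod N)"
    using assms by (intro nth_equalityI)
      (auto simp: pf_index_add_def pf_one_index_nth mod_simps)
  have p: "pf_phase N (pf_one_index n (k - 1) (i mod N)) (pf_one_index n (k - 1) 1) = 1"
    using assms by (auto simp: pf_phase_one_index pf_one_index_nth intro!: prod.neutral)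
  have "pf_gen n k [^]\<^bsub>PF N n\<^esub> Suc i = pf_mult N n (pf_gen n k [^]\<^bsub>PF N n\<^esub> i) (pf_gen n k)"
    by (simp add: nat_pow_def PF_def)
  also have "\<dots> = pf_delta (pf_one_index n (k - 1) (Suc i mod N))"
    unfolding Suc.IH unfolding g pf_delta_mult[OF *] a p by (simp add: pf_scale_def)
  finally show ?case .
qed

lemma pf_gen_closed: "N \<ge> 2 \<Longrightarrow> pf_gen n k \<in> carrier (PF N n)"
  using pf_one_index[of 1 N n "k - 1"]
  by (auto simp: PF_def pf_gen_def pf_delta_def pf_one_index_def)

theorem pf_gen_power_N:
  assumes "N \<ge> 2" "1 \<le> k" "k \<le> n"
  shows "pf_gen n k [^]\<^bsub>PF N n\<^esub> N = \<one>\<^bsub>PF N n\<^esub>"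
  unfolding pf_gen_pow[OF assms] by (simp add: PF_def)

theorem pf_gen_commute:
  assumes "N \<ge> 2" "1 \<le> i" "i < j" "j \<le> n"
  shows "pf_gen n i \<otimes>\<^bsub>PF N n\<^esub> pf_gen n j = pf_q N \<cdot>\<^sub>c (pf_gen n j \<otimes>\<^bsub>PF N n\<^esub> pf_gen n i)"
proof -
  have g: "pf_gen n k = pf_delta (pf_one_index n (k - 1) 1)" for k
    by (simp add: pf_gen_def pf_one_index_def)
  have o: "pf_one_index n k 1 \<in> pf_index N n" for k using assms by (auto intro!: pf_one_index)
  have p1: "pf_phase N (pf_one_index n (i - 1) 1) (pf_one_index n (j - 1) 1) = 1"
    using assms by (auto simp: pf_phase_one_index pf_one_index_nth intro!: prod.neutral)
  have "i - 1 < j - 1" using assms by simp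
  have "pf_phase N (pf_one_index n (j - 1) 1) (pf_one_index n (i - 1) 1) =
      (\<Prod>l<j-1. inverse (pf_q N) ^ (1 * pf_one_index n (i - 1) 1 ! l))"
    using assms by (intro pf_phase_one_index) auto
  also have "\<dots> = (\<Prod>l<j-1. if l = i - 1 then inverse (pf_q N) else 1)"
    using assms by (intro prod.cong) (auto simp: pf_one_index_nth)
  finally have "pf_phase N (pf_one_index n (j - 1) 1) (pf_one_index n (i - 1) 1) =
      (\<Prod>l<j-1. if l = i - 1 then inverse (pf_q N) else 1)" .
  then have p2: "pf_phase N (pf_one_index n (j - 1) 1) (pf_one_index n (i - 1) 1) = inverse (pf_q N)"
    using \<open>i - 1 < j - 1\<close> by simp
  have a: "pf_index_add N (pf_one_index n (i - 1) 1) (pf_one_index n (j - 1) 1) =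
      pf_index_add N (pf_one_index n (j - 1) 1) (pf_one_index n (i - 1) 1)"
    by (auto simp: pf_index_add_def pf_one_index_def add.commute)
  have m: "x \<otimes>\<^bsub>PF N n\<^esub> y = pf_mult N n x y" for x y by (simp add: PF_def)
  show ?thesis unfolding g m pf_delta_mult[OF o o] p1 p2 a
    by (simp add: pf_scale_def fun_eq_iff flip: mult.assoc)
qed

theorem pf_C_eq_delta:
  assumes N: "N \<ge> 2" and I: "I \<in> pf_index N n"
  shows "pf_C N n I = pf_delta I"
proof -
  define D where "D k = map (\<lambda>l. if l < k then 0 else I ! l) [0..<n]" for k
  have D: "D k \<in> pf_index N n" for k
    using N pf_index_nth[OF I] by (auto simp: D_def pf_index_def)
  let ?f = "\<lambda>k y. pf_gen n k [^]\<^bsub>PF N n\<^esub> (I ! (k - 1)) \<otimes>\<^bsub>PF N n\<^esub> y"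
  have "foldr ?f [n + 1 - d..<n + 1] \<one>\<^bsub>PF N n\<^esub> = pf_delta (D (n - d))" if "d \<le> n" for d
    using that
  proof (induction d)
    case 0
    have "D n = replicate n 0" by (auto simp: D_def intro!: nth_equalityI)
    then show ?case by (simp add: PF_def)
  next
    case (Suc d)
    define k where "k = n - Suc d"
    have k: "k < n" "n - d = Suc k" "n + 1 - d = Suc (Suc k)" "n + 1 - Suc d = Suc k"
      using Suc.prems by (auto simp: k_def)
    have Ik: "I ! k < N" using pf_index_nth[OF I k(1)] .
    have "foldr ?f [Suc k..<n + 1] \<one>\<^bsub>PF N n\<^esub> = ?f (Suc k) (foldr ?f [Suc (Suc k)..<n + 1] \<one>\<^bsub>PF N n\<^esub>)"
      using k by (subst upt_conv_Cons) auto
    also have "foldr ?f [Suc (Suc k)..<n + 1] \<one>\<^bsub>PF N n\<^esub> = pf_delta (D (Suc k))"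
      using Suc.IH Suc.prems unfolding k(2,3) by simp
    also have "pf_gen n (Suc k) [^]\<^bsub>PF N n\<^esub> (I ! (Suc k - 1)) = pf_delta (pf_one_index n k (I ! k))"
      using N k Ik by (simp add: pf_gen_pow)
    also have "pf_delta (pf_one_index n k (I ! k)) \<otimes>\<^bsub>PF N n\<^esub> pf_delta (D (Suc k)) =
        pf_phase N (pf_one_index n k (I ! k)) (D (Suc k)) \<cdot>\<^sub>c
          pf_delta (pf_index_add N (pf_one_index n k (I ! k)) (D (Suc k)))"
      using pf_delta_mult[OF pf_one_index[OF Ik] D] by (simp add: PF_def)
    also have "pf_phase N (pf_one_index n k (I ! k)) (D (Suc k)) = 1"
      using k by (auto simp: pf_phase_one_index D_def intro!: prod.neutral)
    also have "pf_index_add N (pf_one_index n k (I ! k)) (D (Suc k)) = D k"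
    proof (rule nth_equalityI)
      fix l assume "l < length (pf_index_add N (pf_one_index n k (I ! k)) (D (Suc k)))"
      then have l: "l < n" by (simp add: pf_index_add_def pf_one_index_def)
      then show "pf_index_add N (pf_one_index n k (I ! k)) (D (Suc k)) ! l = D k ! l"
        using N pf_index_nth[OF I l]
        by (auto simp: pf_index_add_def pf_one_index_nth D_def less_Suc_eq)
    qed (simp add: pf_index_add_def pf_one_index_def D_def)
    finally show ?case unfolding k(4) by (simp add: k_def pf_scale_def)
  qed
  from this[of n] have "pf_C N n I = pf_delta (D 0)" by (simp add: pf_C_def)
  also have "D 0 = I" using pf_index_length[OF I] by (auto simp: D_def intro!: nth_equalityI)
  finally show ?thesis .
qed

theorem pf_basis_expansion:
  assumes "N \<ge> 2" "x \<in> carrier (PF N n)"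
  shows "x = (\<Sum>I\<in>pf_index N n. x I \<cdot>\<^sub>c pf_C N n I)"
proof
  fix K
  have "(\<Sum>I\<in>pf_index N n. x I \<cdot>\<^sub>c pf_C N n I) K = (\<Sum>I\<in>pf_index N n. if I = K then x K else 0)"
    unfolding pf_sum_apply
    by (intro sum.cong) (use assms in \<open>auto simp: pf_C_eq_delta pf_scale_def pf_delta_def\<close>)
  then show "x K = (\<Sum>I\<in>pf_index N n. x I \<cdot>\<^sub>c pf_C N n I) K"
    using assms(2) by (auto simp: PF_def)
qed

theorem pf_tr_C:
  assumes "N \<ge> 2" "I \<in> pf_index N n"
  shows "pf_tr n (pf_C N n I) = (if I = replicate n 0 then 1 else 0)"
  using assms by (auto simp: pf_C_eq_delta pf_tr_def pf_delta_def)

theorem pf_gen_inv: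
  assumes "N \<ge> 2" "1 \<le> k" "k \<le> n"
  shows "pf_gen n k \<in> Units (PF N n)"
    and "inv\<^bsub>PF N n\<^esub> (pf_gen n k) = pf_gen n k [^]\<^bsub>PF N n\<^esub> (N - 1)"
proof -
  interpret ring "PF N n" using PF_ring assms by simp
  have c: "pf_gen n k \<in> carrier (PF N n)" using pf_gen_closed assms by simp
  have *: "pf_gen n k \<otimes>\<^bsub>PF N n\<^esub> pf_gen n k [^]\<^bsub>PF N n\<^esub> (N - 1) = \<one>\<^bsub>PF N n\<^esub>"
    using nat_pow_Suc2[OF c, of "N - 1"] pf_gen_power_N[OF assms] assms by simp
  have **: "pf_gen n k [^]\<^bsub>PF N n\<^esub> (N - 1) \<otimes>\<^bsub>PF N n\<^esub> pf_gen n k = \<one>\<^bsub>PF N n\<^esub>"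
    using nat_pow_Suc[of "pf_gen n k" "N - 1"] pf_gen_power_N[OF assms] assms by simp
  show "pf_gen n k \<in> Units (PF N n)"
    using * ** c by (auto simp: Units_def intro!: bexI[of _ "pf_gen n k [^]\<^bsub>PF N n\<^esub> (N - 1)"])
  show "inv\<^bsub>PF N n\<^esub> (pf_gen n k) = pf_gen n k [^]\<^bsub>PF N n\<^esub> (N - 1)"
    using * ** c by (intro inv_unique'[symmetric]) auto
qed


subsection \<open>Convergence of the exponential series\<close>

definition pf_l1 :: "nat \<Rightarrow> nat \<Rightarrow> pf \<Rightarrow> real" where
  "pf_l1 N n x = (\<Sum>I\<in>pf_index N n. norm (x I))"

lemma norm_pf_phase [simp]: "norm (pf_phase N I J) = 1"
  by (simp add: pf_phase_def pf_q_def norm_power norm_inverse)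

lemma pf_l1_mult: "pf_l1 N n (pf_mult N n x y) \<le> pf_l1 N n x * pf_l1 N n y"
proof -
  let ?X = "pf_index N n"
  have "pf_l1 N n (pf_mult N n x y) \<le> (\<Sum>K\<in>?X. \<Sum>I\<in>?X. \<Sum>J\<in>?X.
     if K = pf_index_add N I J then norm (x I) * norm (y J) else 0)"
    unfolding pf_l1_def pf_mult_apply
    by (intro sum_mono order.trans[OF norm_sum]) (auto simp: norm_mult)
  also have "\<dots> = (\<Sum>I\<in>?X. \<Sum>K\<in>?X. \<Sum>J\<in>?X.
     if K = pf_index_add N I J then norm (x I) * norm (y J) else 0)"
    by (rule sum.swap)
  also have "\<dots> = (\<Sum>I\<in>?X. \<Sum>J\<in>?X. \<Sum>K\<in>?X.
     if K = pf_index_add N I J then norm (x I) * norm (y J) else 0)"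
    by (intro sum.cong refl sum.swap)
  also have "\<dots> \<le> (\<Sum>I\<in>?X. \<Sum>J\<in>?X. norm (x I) * norm (y J))"
    by (intro sum_mono) (simp add: sum.delta)
  also have "\<dots> = pf_l1 N n x * pf_l1 N n y"
    by (simp add: pf_l1_def sum_product)
  finally show ?thesis .
qed

lemma pf_l1_pow:
  assumes "N > 0"
  shows "pf_l1 N n (x [^]\<^bsub>PF N n\<^esub> (k::nat)) \<le> pf_l1 N n x ^ k"
proof (induction k)
  case 0
  have "(\<Sum>I\<in>pf_index N n. if I = replicate n 0 then 1 else 0 :: real) = 1"
    using pf_index_zero[OF assms, of n] by simp
  then show ?case
    by (simp add: nat_pow_def PF_def pf_l1_def pf_delta_def if_distrib cong: if_cong)
next
  case (Suc k)
  have "pf_l1 N n (x [^]\<^bsub>PF N n\<^esub> Suc k) \<le> pf_l1 N n (x [^]\<^bsub>PF N n\<^esub> k) * pf_l1 N n x"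
    using pf_l1_mult[of N n "x [^]\<^bsub>PF N n\<^esub> k" x] by (simp add: nat_pow_def PF_def)
  also have "\<dots> \<le> pf_l1 N n x ^ k * pf_l1 N n x"
    by (rule mult_right_mono[OF Suc]) (simp add: pf_l1_def sum_nonneg)
  finally show ?case by (simp add: mult.commute)
qed

theorem pf_exp_sums:
  assumes "N > 0" "x \<in> carrier (PF N n)"
  shows "(\<lambda>k. (x [^]\<^bsub>PF N n\<^esub> (k::nat)) I / fact k) sums pf_exp N n x I"
proof -
  interpret ring "PF N n" using PF_ring assms by simp
  have "norm ((x [^]\<^bsub>PF N n\<^esub> k) I) \<le> pf_l1 N n x ^ k" for k
  proof (cases "I \<in> pf_index N n")
    case True
    then have "norm ((x [^]\<^bsub>PF N n\<^esub> k) I) \<le> pf_l1 N n (x [^]\<^bsub>PF N n\<^esub> k)"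
      unfolding pf_l1_def by (intro member_le_sum) auto
    then show ?thesis using pf_l1_pow[OF assms(1), of n x k] by linarith
  next
    case False
    then have "(x [^]\<^bsub>PF N n\<^esub> k) I = 0"
      using nat_pow_closed[OF assms(2), of k] by (simp add: PF_def)
    then show ?thesis by (simp add: pf_l1_def sum_nonneg)
  qed
  then have "norm ((x [^]\<^bsub>PF N n\<^esub> k) I / fact k) \<le> inverse (fact k) * pf_l1 N n x ^ k" for k
    by (simp add: norm_divide divide_simps)
  then have "summable (\<lambda>k. (x [^]\<^bsub>PF N n\<^esub> (k::nat)) I / fact k)"
    by (intro summable_comparison_test'[OF summable_exp, where N = 0])
  then show ?thesis by (simp add: pf_exp_def summable_sums)
qed

end

theory Submission
  imports Defs "HOL-Analysis.Analysis"
begin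

text \<open>Write $T(x,y) = \Theta(x) \otimes_t y$. The twist $\zeta^{ij}$ is chosen so that the phase
  $q^{ii'}$ arising when a $\sigma(y)$ of grading $i$ moves past a $\Theta(x')$, $x'$ of grading
  $i'$, completes the square $\zeta^{i^2}\zeta^{i'^2}\zeta^{2ii'} = \zeta^{(i+i')^2}$. Hence $T$ is
  multiplicative, $T(x,y)\,T(x',y') = T(xx',yy')$, whenever $x,y$ have one grading and $x',y'$ have
  one grading (\<open>twist_mult\<close>), and for such $x,y$ and arbitrary $x',y'$ the trace factorizes:
  $\mathrm{tr}(T(x,y)\,T(x',y')) = \overline{\mathrm{tr}(xx')}\,\mathrm{tr}(yy')$
  (\<open>trace_twist_mult\<close>). Consequently the cone spanned by the squares $T(y,y)$ of homogeneous
  elements is closed under products, and each of its elements has a nonnegative trace against every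
  $T(x,x)$. A grading-preserving positive semi-definite matrix $M$ gives an element
  $\sum M_{IJ}\,T(C_I,C_J)$ of the cone, because $M$ is a sum of rank one matrices. Since $-H$ has
  grading $0$, its matrix $J$ preserves the grading.

  For the direction from $J_0 \ge 0$ to reflection positivity, the entries of $J$ in the row and
  column of the empty index have to be absorbed. As $J$ is Hermitian,
  $-H = J_{00} + T(1,\kappa) + T(\kappa,1) + P$ with $\kappa = \sum_{I\ne0} J_{0I} C_I$ and
  $P$ in the cone by hypothesis. For every $s>0$,
  \[ -H + s^{-2}\,T(\kappa,\kappa) = T(s+s^{-1}\kappa,\, s+s^{-1}\kappa) + P + (J_{00} - s^2). \]
  The right side is an element of the cone plus a real scalar, so its exponential is a positive
  multiple of the exponential of an element of the cone, which has a nonnegative trace against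
  $T(x,x)$ term by term. Letting $s\to\infty$ gives the claim for $-H$ itself.

  Conversely, if $\mathrm{tr}(x)=0$ then $\mathrm{tr}(e^{-\beta H}T(x,x))$ vanishes at $\beta=0$, so
  nonnegativity for small $\beta$ forces the derivative $\mathrm{tr}(-H\,T(x,x)) =
  \sum J_{IJ}\,\overline{v_I}\,v_J$ with $v_I = \mathrm{tr}(C_Ix)$ to be nonnegative. Every vector $v$
  with $v_0=0$ arises from a suitable $x$, which is the statement $J_0\ge0$.\<close>

section \<open>Multi-indices and reordering phases\<close>

text \<open>The index of $\Theta(C_I)$: the generator $c_j$ goes to $c_{n+1-j}^{-1}$, so exponents
  are negated and reversed.\<close>

definition pf_reflect :: "nat \<Rightarrow> nat list \<Rightarrow> nat list" where
  "pf_reflect N I = rev (map (\<lambda>i. (N - i) mod N) I)"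

lemma length_pf_reflect [simp]: "length (pf_reflect N I) = length I"
  by (simp add: pf_reflect_def)

lemma pf_reflect_nth:
  "k < length I \<Longrightarrow> pf_reflect N I ! k = (N - I ! (length I - 1 - k)) mod N"
  by (simp add: pf_reflect_def rev_nth)

lemma pf_reflect_closed: "N > 0 \<Longrightarrow> I \<in> pf_index N n \<Longrightarrow> pf_reflect N I \<in> pf_index N n"
  by (auto simp: pf_reflect_def pf_index_def)

lemma pf_reflect_append: "pf_reflect N (I @ J) = pf_reflect N J @ pf_reflect N I"
  by (simp add: pf_reflect_def)

lemma pf_reflect_zero [simp]: "pf_reflect N (replicate n 0) = replicate n 0"
  by (simp add: pf_reflect_def)

lemma pf_neg_neg: "i < N \<Longrightarrow> (N - (N - i) mod N) mod N = (i::nat)"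
  by (cases "i = 0") auto

lemma pf_reflect_reflect: "I \<in> pf_index N n \<Longrightarrow> pf_reflect N (pf_reflect N I) = I"
  by (auto simp: pf_reflect_def pf_index_def rev_map pf_neg_neg subset_iff intro!: map_idI)

lemma pf_neg_add:
  fixes i j N :: nat
  assumes "i < N" "j < N"
  shows "(N - (i + j) mod N) mod N = ((N - i) mod N + (N - j) mod N) mod N"
proof -
  have "((N - i) + (N - j)) mod N = (N - (i + j) mod N) mod N"
  proof (cases "i + j \<le> N")
    case True
    then have "(N - i) + (N - j) = (N - (i + j)) + N" using assms by simp
    then have "((N - i) + (N - j)) mod N = (N - (i + j)) mod N" by simp
    then show ?thesis using True by (cases "i + j = N") auto
  next
    case False
    then have "(N - i) + (N - j) = N - (i + j - N)" "(i + j) mod N = i + j - N"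
      using assms by (simp_all add: le_mod_geq)
    then show ?thesis by simp
  qed
  then show ?thesis by (simp only: mod_add_eq)
qed

lemma pf_reflect_add:
  assumes "I \<in> pf_index N n" "J \<in> pf_index N n"
  shows "pf_reflect N (pf_index_add N I J) = pf_index_add N (pf_reflect N I) (pf_reflect N J)"
proof (rule nth_equalityI)
  fix k assume "k < length (pf_reflect N (pf_index_add N I J))"
  then have k: "k < n" using assms by (simp add: pf_index_add_def pf_index_length)
  then have "n - 1 - k < n" by simp
  with k assms show "pf_reflect N (pf_index_add N I J) ! k =
      pf_index_add N (pf_reflect N I) (pf_reflect N J) ! k"
    by (simp add: pf_index_add_def pf_reflect_nth pf_index_length pf_neg_add pf_index_nth)
qed (simp add: pf_index_add_def)

lemma pf_reflect_inj: "I \<in> pf_index N n \<Longrightarrow> J \<in> pf_index N n \<Longrightarrow>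
   pf_reflect N I = pf_reflect N J \<longleftrightarrow> I = J"
  by (metis pf_reflect_reflect)

lemma pf_reflect_eq_zero: "I \<in> pf_index N n \<Longrightarrow> N > 0 \<Longrightarrow>
   pf_reflect N I = replicate n 0 \<longleftrightarrow> I = replicate n 0"
  by (metis pf_index_zero pf_reflect_inj pf_reflect_zero)

lemma pf_phase_prod:
  "length I = n \<Longrightarrow> pf_phase N I J = (\<Prod>(k,l)\<in>{(k,l). k < n \<and> l < k}. inverse (pf_q N) ^ (I ! k * J ! l))"
  unfolding pf_phase_eq
  by (subst prod.Sigma) (auto intro!: prod.cong)

lemma pf_q_neg_mult:
  assumes "N > 0" "i < N" "j < N"
  shows "inverse (pf_q N) ^ ((N - i) mod N * ((N - j) mod N)) = inverse (pf_q N) ^ (i * j)"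
proof -
  obtain a where a: "N = i + a" using assms less_imp_add_positive by metis
  obtain b where b: "N = j + b" using assms less_imp_add_positive by metis
  have "(N - i) * (N - j) + N * j = i * j + N * (N - i)"
  proof -
    have ab: "N - i = a" "N - j = b" using a b by simp_all
    have "a * b + N * j = a * b + (i + a) * j" using a by simp
    also have "\<dots> = i * j + a * (j + b)" by (simp add: algebra_simps)
    also have "\<dots> = i * j + N * a" using b by simp
    finally show ?thesis using ab by simp
  qed
  then have e: "((N - i) * (N - j)) mod N = (i * j) mod N"
    by (metis mod_mult_self2)
  show ?thesis
    using pf_q_mod[OF assms(1), of "(N - i) * (N - j)"] pf_q_mod[OF assms(1), of "i * j"]
    by (simp add: pf_q_mod_mult[OF assms(1)] e)
qed

text \<open>Negating both exponents leaves each factor $q^{-i_kj_l}$ unchanged, and reversing the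
  positions turns the condition $l<k$ into $k<l$. This expresses on the level of phases that $\Theta$
  is an antilinear homomorphism.\<close>

lemma pf_phase_reflect:
  assumes "N > 0" "I \<in> pf_index N n" "J \<in> pf_index N n"
  shows "pf_phase N (pf_reflect N I) (pf_reflect N J) = pf_phase N J I"
proof -
  let ?P = "{(k,l). k < n \<and> l < (k::nat)}"
  have "pf_phase N (pf_reflect N I) (pf_reflect N J) =
     (\<Prod>(k,l)\<in>?P. inverse (pf_q N) ^ (pf_reflect N I ! k * pf_reflect N J ! l))"
    using assms by (intro pf_phase_prod) (simp add: pf_index_length)
  also have "\<dots> = (\<Prod>(k,l)\<in>?P. inverse (pf_q N) ^ (J ! k * I ! l))"
  proof (rule prod.reindex_bij_witness[of _ "\<lambda>(k,l). (n - 1 - l, n - 1 - k)" "\<lambda>(k,l). (n - 1 - l, n - 1 - k)"])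
    fix p assume "p \<in> ?P"
    then obtain k l where p: "p = (k,l)" "k < n" "l < k" by auto
    then have n: "n - 1 - k < n" "n - 1 - l < n" "l < n" by auto
    show "(case (case p of (k,l) \<Rightarrow> (n - 1 - l, n - 1 - k)) of
        (k,l) \<Rightarrow> inverse (pf_q N) ^ (J ! k * I ! l)) =
      (case p of (k,l) \<Rightarrow> inverse (pf_q N) ^ (pf_reflect N I ! k * pf_reflect N J ! l))"
      using assms p n
      by (simp add: pf_reflect_nth pf_index_length pf_q_neg_mult pf_index_nth mult.commute)
  qed auto
  also have "\<dots> = pf_phase N J I"
    using assms by (intro pf_phase_prod[symmetric]) (simp add: pf_index_length)
  finally show ?thesis .
qed

text \<open>Joining two blocks costs, apart from the phases inside the blocks, the phase of moving the second
  factor's left block past the first factor's right block; it depends on the gradings only.\<close>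

lemma pf_phase_append:
  assumes "length K = length K'"
  shows "pf_phase N (K @ L) (K' @ L') =
    pf_phase N K K' * pf_phase N L L' * inverse (pf_q N) ^ (sum_list L * sum_list K')"
proof -
  have split: "(\<Sum>k<a + b. f k) = (\<Sum>k<a. f k) + (\<Sum>k<b. f (a + k))" for a b and f :: "nat \<Rightarrow> nat"
    by (induction b) (auto simp: add.assoc)
  have "(\<Sum>k<length (K @ L). \<Sum>l<k. (K @ L) ! k * (K' @ L') ! l) =
    (\<Sum>k<length K. \<Sum>l<k. K ! k * K' ! l) +
    (\<Sum>k<length L. L ! k * sum_list K' + (\<Sum>l<k. L ! k * L' ! l))"
    using assms
    by (simp add: split nth_append sum_list_sum_nth atLeast0LessThan sum_distrib_left)
  also have "\<dots> = (\<Sum>k<length K. \<Sum>l<k. K ! k * K' ! l) + (\<Sum>k<length L. \<Sum>l<k. L ! k * L' ! l)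
     + sum_list L * sum_list K'"
    by (simp add: sum.distrib sum_list_sum_nth[of L] atLeast0LessThan flip: sum_distrib_right)
  finally show ?thesis by (simp add: pf_phase_def power_add)
qed

lemma pf_index_add_append:
  "length K = length K' \<Longrightarrow>
   pf_index_add N (K @ L) (K' @ L') = pf_index_add N K K' @ pf_index_add N L L'"
  by (rule nth_equalityI) (auto simp: pf_index_add_def nth_append)

lemma pf_index_append:
  "K \<in> pf_index N m \<Longrightarrow> L \<in> pf_index N m \<Longrightarrow> K @ L \<in> pf_index N (2 * m)"
  by (auto simp: pf_index_def)

lemma pf_grade_add:
  "length I = length J \<Longrightarrow> sum_list (pf_index_add N I J) mod N = (sum_list I + sum_list J) mod N"
proof -
  assume l: "length I = length J"
  have "sum_list (pf_index_add N I J) mod N = (\<Sum>k<length I. (I ! k + J ! k) mod N) mod N"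
    by (simp add: pf_index_add_def sum_list_sum_nth atLeast0LessThan)
  also have "\<dots> = (\<Sum>k<length I. I ! k + J ! k) mod N" by (rule mod_sum_eq)
  finally show ?thesis using l
    by (simp add: sum.distrib sum_list_sum_nth atLeast0LessThan)
qed

lemma pf_grade_reflect:
  "set I \<subseteq> {..<N} \<Longrightarrow> N dvd sum_list (pf_reflect N I) + sum_list I"
proof (induction I)
  case (Cons i I)
  have i: "N dvd (N - i) mod N + i"
    using Cons.prems by (cases "i = 0") auto
  have "N dvd sum_list (pf_reflect N I) + sum_list I"
    using Cons.prems by (intro Cons.IH) auto
  then have "N dvd (sum_list (pf_reflect N I) + sum_list I) + ((N - i) mod N + i)"
    using i by (rule dvd_add)
  also have "(sum_list (pf_reflect N I) + sum_list I) + ((N - i) mod N + i) =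
      sum_list (pf_reflect N (i # I)) + sum_list (i # I)"
    by (simp add: pf_reflect_def)
  finally show ?case .
qed (simp add: pf_reflect_def)

lemma pf_index_add_eq_zero:
  assumes I: "I \<in> pf_index N n" and K: "K \<in> pf_index N n"
  shows "pf_index_add N I K = replicate n 0 \<longleftrightarrow> K = map (\<lambda>i. (N - i) mod N) I"
proof -
  have num: "(i + k) mod N = 0 \<longleftrightarrow> k = (N - i) mod N" if "i < N" "k < N" for i k
  proof (cases "i = 0")
    case False
    have "(i + k) mod N = (if i + k < N then i + k else i + k - N)"
      using that by (simp add: le_mod_geq)
    then show ?thesis using False that by auto
  qed (use that in auto)
  have len: "length I = n" "length K = n" using I K by (auto simp: pf_index_length)
  have "pf_index_add N I K = replicate n 0 \<longleftrightarrow> (\<forall>k<n. (I ! k + K ! k) mod N = 0)"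
    using len by (auto simp: list_eq_iff_nth_eq pf_index_add_def)
  also have "\<dots> \<longleftrightarrow> (\<forall>k<n. K ! k = (N - I ! k) mod N)"
    using num pf_index_nth[OF I] pf_index_nth[OF K] by simp
  also have "\<dots> \<longleftrightarrow> K = map (\<lambda>i. (N - i) mod N) I"
    using len by (auto simp: list_eq_iff_nth_eq)
  finally show ?thesis .
qed

lemma mod_add_cancel:
  assumes "(a + i) mod N = (a + j) mod N" "a < N" "i < N" "j < (N::nat)"
  shows "i = j"
proof -
  have "((N - a) + (a + k) mod N) mod N = k" if "k < N" for k
  proof -
    have "((N - a) + (a + k) mod N) mod N = ((N - a) + (a + k)) mod N" by (rule mod_add_right_eq)
    also have "(N - a) + (a + k) = N + k" using assms by simp
    finally show ?thesis using that by simp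
  qed
  then show ?thesis using assms by metis
qed

section \<open>Linear combinations and the reflection of the basis\<close>

lemma sum_pair: "(\<Sum>i\<in>A. \<Sum>j\<in>B. g i j) = (\<Sum>p\<in>A \<times> B. g (fst p) (snd p))"
  by (simp add: sum.cartesian_product case_prod_beta)

lemma sum_swap_pairs:
  fixes f :: "'a \<Rightarrow> 'b \<Rightarrow> 'c \<Rightarrow> 'd \<Rightarrow> 'e::comm_monoid_add"
  shows "(\<Sum>i\<in>A. \<Sum>j\<in>B. \<Sum>k\<in>C. \<Sum>l\<in>D. f i j k l) = (\<Sum>k\<in>C. \<Sum>l\<in>D. \<Sum>i\<in>A. \<Sum>j\<in>B. f i j k l)"
proof -
  have "(\<Sum>i\<in>A. \<Sum>j\<in>B. \<Sum>k\<in>C. \<Sum>l\<in>D. f i j k l) =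
      (\<Sum>p\<in>A \<times> B. \<Sum>r\<in>C \<times> D. f (fst p) (snd p) (fst r) (snd r))"
    by (subst sum_pair, subst sum_pair) (rule refl)
  also have "\<dots> = (\<Sum>r\<in>C \<times> D. \<Sum>p\<in>A \<times> B. f (fst p) (snd p) (fst r) (snd r))"
    by (rule sum.swap)
  also have "\<dots> = (\<Sum>k\<in>C. \<Sum>l\<in>D. \<Sum>i\<in>A. \<Sum>j\<in>B. f i j k l)"
    by (subst (2) sum_pair, subst (2) sum_pair) (rule refl)
  finally show ?thesis .
qed

lemma sum_swap_middle:
  "(\<Sum>i\<in>A. \<Sum>j\<in>B. \<Sum>k\<in>C. \<Sum>l\<in>D. f i j k l) = (\<Sum>i\<in>A. \<Sum>k\<in>C. \<Sum>j\<in>B. \<Sum>l\<in>D. f i j k l)"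
  by (intro sum.cong refl sum.swap)

lemma sum_product_pairs:
  fixes f g :: "_ \<Rightarrow> _ \<Rightarrow> 'a::comm_ring_1"
  shows "(\<Sum>i\<in>A. \<Sum>j\<in>B. f i j) * (\<Sum>k\<in>C. \<Sum>l\<in>D. g k l) =
    (\<Sum>i\<in>A. \<Sum>j\<in>B. \<Sum>k\<in>C. \<Sum>l\<in>D. f i j * g k l)"
  unfolding sum_distrib_right unfolding sum_distrib_left by (rule refl)

lemma pf_mult_zero [simp]: "pf_mult N n 0 y = 0" "pf_mult N n x 0 = 0"
  by (rule ext, simp add: pf_mult_apply if_distrib cong: if_cong)+

lemma pf_mult_sum_left: "pf_mult N n (\<Sum>a\<in>A. f a) y = (\<Sum>a\<in>A. pf_mult N n (f a) y)"
proof (induction A rule: infinite_finite_induct)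
  case (insert a A)
  then show ?case by (simp only: sum.insert pf_mult_distrib not_False_eq_True)
qed (simp_all only: sum.infinite sum.empty pf_mult_zero not_False_eq_True)

lemma pf_mult_sum_right: "pf_mult N n x (\<Sum>a\<in>A. f a) = (\<Sum>a\<in>A. pf_mult N n x (f a))"
proof (induction A rule: infinite_finite_induct)
  case (insert a A)
  then show ?case by (simp only: sum.insert pf_mult_distrib not_False_eq_True)
qed (simp_all only: sum.infinite sum.empty pf_mult_zero not_False_eq_True)

lemma pf_scale_sum: "c \<cdot>\<^sub>c (\<Sum>a\<in>A. f a) = (\<Sum>a\<in>A. c \<cdot>\<^sub>c f a)"
  by (simp add: fun_eq_iff pf_scale_def pf_sum_apply sum_distrib_left)

lemma pf_sum_scale: "(\<Sum>a\<in>A. f a) \<cdot>\<^sub>c x = (\<Sum>a\<in>A. f a \<cdot>\<^sub>c x)"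
  by (simp add: fun_eq_iff pf_scale_def pf_sum_apply sum_distrib_right)

lemma pf_scale_scale [simp]: "c \<cdot>\<^sub>c d \<cdot>\<^sub>c x = (c * d) \<cdot>\<^sub>c x"
  by (simp add: pf_scale_def mult.assoc)

lemma pf_scale_one [simp]: "1 \<cdot>\<^sub>c x = x"
  by (simp add: pf_scale_def)

lemma pf_scale_zero [simp]: "0 \<cdot>\<^sub>c x = 0" "c \<cdot>\<^sub>c 0 = 0"
  by (simp_all add: pf_scale_def fun_eq_iff)

lemma pf_scale_add: "c \<cdot>\<^sub>c (x + y) = c \<cdot>\<^sub>c x + c \<cdot>\<^sub>c y"
  by (simp add: pf_scale_def fun_eq_iff algebra_simps)

lemma pf_add_scale: "(c + d) \<cdot>\<^sub>c x = c \<cdot>\<^sub>c x + d \<cdot>\<^sub>c x"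
  by (simp add: pf_scale_def fun_eq_iff algebra_simps)

lemma PF_mult [simp]: "x \<otimes>\<^bsub>PF N n\<^esub> y = pf_mult N n x y"
  by (simp add: PF_def)

lemma PF_one: "\<one>\<^bsub>PF N n\<^esub> = pf_delta (replicate n 0)"
  by (simp add: PF_def)

lemma PF_carrier: "x \<in> carrier (PF N n) \<longleftrightarrow> (\<forall>I. I \<notin> pf_index N n \<longrightarrow> x I = 0)"
  by (simp add: PF_def)

text \<open>An antilinear (respectively linear) map given by its values \<open>g\<close> on the basis may be evaluated on any
  linear combination of basis elements, also one with repetitions such as the expansion of a product.\<close>

lemma pf_antilinear_subst:
  assumes "finite A" "\<And>a. a \<in> A \<Longrightarrow> f a \<in> pf_index N n"
  shows "(\<Sum>I\<in>pf_index N n. cnj ((\<Sum>a\<in>A. s a \<cdot>\<^sub>c pf_delta (f a)) I) \<cdot>\<^sub>c (g I :: pf)) =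
    (\<Sum>a\<in>A. cnj (s a) \<cdot>\<^sub>c g (f a))"
proof
  fix K
  have "(\<Sum>I\<in>pf_index N n. cnj ((\<Sum>a\<in>A. s a \<cdot>\<^sub>c pf_delta (f a)) I) \<cdot>\<^sub>c g I) K =
    (\<Sum>I\<in>pf_index N n. \<Sum>a\<in>A. if I = f a then cnj (s a) * g I K else 0)"
    by (simp add: pf_sum_apply pf_scale_def pf_delta_def sum_distrib_right)
      (intro sum.cong, auto)
  also have "\<dots> = (\<Sum>a\<in>A. \<Sum>I\<in>pf_index N n. if I = f a then cnj (s a) * g I K else 0)"
    by (rule sum.swap)
  also have "\<dots> = (\<Sum>a\<in>A. cnj (s a) * g (f a) K)"
    using assms by (intro sum.cong) auto
  finally show "(\<Sum>I\<in>pf_index N n. cnj ((\<Sum>a\<in>A. s a \<cdot>\<^sub>c pf_delta (f a)) I) \<cdot>\<^sub>c g I) K =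
    (\<Sum>a\<in>A. cnj (s a) \<cdot>\<^sub>c g (f a)) K"
    by (simp add: pf_sum_apply pf_scale_def)
qed

lemma pf_linear_subst:
  assumes "finite A" "\<And>a. a \<in> A \<Longrightarrow> f a \<in> pf_index N n"
  shows "(\<Sum>I\<in>pf_index N n. (\<Sum>a\<in>A. s a \<cdot>\<^sub>c pf_delta (f a)) I \<cdot>\<^sub>c (g I :: pf)) =
    (\<Sum>a\<in>A. s a \<cdot>\<^sub>c g (f a))"
  using pf_antilinear_subst[OF assms, where s = "\<lambda>a. cnj (s a)" and g = g]
  by (simp add: pf_sum_apply pf_scale_def pf_delta_def if_distrib[of cnj] cong: if_cong)

lemma cnj_pf_phase: "cnj (pf_phase N I J) = inverse (pf_phase N I J)"
  using norm_pf_phase[of N I J] by (metis complex_cnj_inverse complex_div_cnj inverse_eq_divide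
      mult.right_neutral complex_norm_square inverse_unique norm_one power_one of_real_1)

lemma pf_phase_nz [simp]: "pf_phase N I J \<noteq> 0"
  using norm_pf_phase[of N I J] by (metis norm_zero zero_neq_one)

text \<open>The factors of $\Theta(C_I)$ come in descending order of the generators. Multiplying from the left
  by the next higher generator collects one factor $q^{-k_pk_l}$ for each generator $l<p$ already
  present, where $K$ is the reflected index; together these are the phase of $K$ with itself, which
  equals that of $I$ with itself.\<close>

lemma pf_Theta_C_eq:
  assumes N: "N \<ge> 2" and I: "I \<in> pf_index N n"
  shows "pf_Theta_C N n I = pf_phase N I I \<cdot>\<^sub>c pf_delta (pf_reflect N I)"
proof -
  define K where "K = pf_reflect N I"
  have K: "K \<in> pf_index N n" using N I by (simp add: K_def pf_reflect_closed)
  have len: "length I = n" "length K = n" using I K by (auto simp: pf_index_length)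
  define D where "D d = map (\<lambda>l. if l < d then K ! l else 0) [0..<n]" for d
  have D: "D d \<in> pf_index N n" for d
    using N pf_index_nth[OF K] by (auto simp: D_def pf_index_def)
  let ?f = "\<lambda>k y. (inv\<^bsub>PF N n\<^esub> (pf_gen n (n + 1 - k))) [^]\<^bsub>PF N n\<^esub> (I ! (k - 1)) \<otimes>\<^bsub>PF N n\<^esub> y"
  interpret ring "PF N n" using PF_ring N by simp
  have "foldr ?f [n + 1 - d..<n + 1] \<one>\<^bsub>PF N n\<^esub> = pf_phase N (D d) (D d) \<cdot>\<^sub>c pf_delta (D d)"
    if "d \<le> n" for d
    using that
  proof (induction d)
    case 0
    have "D 0 = replicate n 0" by (auto simp: D_def intro!: nth_equalityI)
    then show ?case by (simp add: PF_one)
  next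
    case (Suc d)
    have d: "d < n" "n + 1 - Suc d = n - d" "n + 1 - d = Suc (n - d)" "n - d - 1 = n - 1 - d"
      "n + 1 - (n - d) = Suc d" using Suc.prems by auto
    have Id: "I ! (n - 1 - d) < N" using I d(1) by (intro pf_index_nth[OF I]) auto
    have Kd: "K ! d = (N - I ! (n - 1 - d)) mod N"
      using d(1) len by (simp add: K_def pf_reflect_nth)
    have KdN: "K ! d < N" using pf_index_nth[OF K d(1)] .
    let ?O = "pf_one_index n d (K ! d)"
    have O: "?O \<in> pf_index N n" using KdN by (rule pf_one_index)
    have "((N - 1) * I ! (n - 1 - d)) mod N = K ! d"
    proof (cases "I ! (n - 1 - d)")
      case (Suc j)
      have "(N - 1) * Suc j = (N - Suc j) + N * j"
        using Id Suc by (cases N) (auto simp: algebra_simps)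
      then show ?thesis using Suc Kd by simp
    qed (use Kd in simp)
    then have g: "(inv\<^bsub>PF N n\<^esub> (pf_gen n (n + 1 - (n - d)))) [^]\<^bsub>PF N n\<^esub> (I ! (n - d - 1)) = pf_delta ?O"
      using N d(1) unfolding d(4,5)
      by (subst pf_gen_inv(2)) (simp_all add: nat_pow_pow pf_gen_closed, simp add: pf_gen_pow)
    have "foldr ?f [n + 1 - Suc d..<n + 1] \<one>\<^bsub>PF N n\<^esub> =
        ?f (n - d) (foldr ?f [n + 1 - d..<n + 1] \<one>\<^bsub>PF N n\<^esub>)"
      unfolding d(2,3) using d(1) by (subst upt_conv_Cons) auto
    also have "\<dots> = pf_mult N n (pf_delta ?O) (pf_phase N (D d) (D d) \<cdot>\<^sub>c pf_delta (D d))"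
      unfolding g using Suc.IH Suc.prems by simp
    also have "\<dots> = (pf_phase N (D d) (D d) * pf_phase N ?O (D d)) \<cdot>\<^sub>c pf_delta (pf_index_add N ?O (D d))"
      by (simp add: pf_mult_scale pf_delta_mult[OF O D])
    also have a: "pf_index_add N ?O (D d) = D (Suc d)"
      using N d(1) pf_index_nth[OF K]
      by (intro nth_equalityI) (auto simp: pf_index_add_def pf_one_index_nth D_def less_Suc_eq)
    also have "pf_phase N (D d) (D d) * pf_phase N ?O (D d) = pf_phase N (D (Suc d)) (D (Suc d))"
    proof -
      have 1: "pf_phase N ?O ?O = 1"
        using d(1) by (auto simp: pf_phase_one_index pf_one_index_nth intro!: prod.neutral)
      have 2: "pf_phase N (D d) ?O = 1"
        unfolding pf_phase_eq using d(1)
        by (intro prod.neutral ballI) (auto simp: D_def pf_one_index_nth)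
      show ?thesis unfolding a[symmetric] using N O D[of d] 1 2
        by (simp add: pf_phase_add[where n = n] pf_index_add_closed)
    qed
    finally show ?case .
  qed
  from this[of n] have "pf_Theta_C N n I = pf_phase N (D n) (D n) \<cdot>\<^sub>c pf_delta (D n)"
    by (simp add: pf_Theta_C_def)
  also have "D n = K" using len by (auto simp: D_def intro!: nth_equalityI)
  finally show ?thesis using N I by (simp add: K_def pf_phase_reflect)
qed

lemma pf_mult_expand:
  "pf_mult N n x y = (\<Sum>I\<in>pf_index N n. \<Sum>J\<in>pf_index N n.
     (x I * y J) \<cdot>\<^sub>c pf_mult N n (pf_delta I) (pf_delta J))"
  unfolding pf_mult_def[of N n x y] by (intro sum.cong refl) (simp add: pf_delta_mult)

lemma pf_tr_sum: "pf_tr n (\<Sum>a\<in>A. f a) = (\<Sum>a\<in>A. pf_tr n (f a))"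
  by (simp add: pf_tr_def pf_sum_apply)

lemma pf_tr_scale: "pf_tr n (c \<cdot>\<^sub>c x) = c * pf_tr n x"
  by (simp add: pf_tr_def pf_scale_def)

lemma pf_tr_add: "pf_tr n (x + y) = pf_tr n x + pf_tr n y"
  by (simp add: pf_tr_def)

section \<open>Traces against the exponential\<close>

lemma nonneg_Reals_sums:
  fixes f :: "nat \<Rightarrow> complex"
  assumes "\<And>k. f k \<in> \<real>\<^sub>\<ge>\<^sub>0" "f sums s"
  shows "s \<in> \<real>\<^sub>\<ge>\<^sub>0"
proof -
  have "(\<Sum>k<n. f k) \<in> \<real>\<^sub>\<ge>\<^sub>0" for n
    using assms(1) by (induction n) (auto intro: nonneg_Reals_add_I)
  then show ?thesis
    using assms(2) unfolding sums_def
    by (rule closed_sequentially[OF closed_nonneg_Reals_complex, of "\<lambda>n. \<Sum>k<n. f k"])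
qed

abbreviation pf_pow :: "nat \<Rightarrow> nat \<Rightarrow> pf \<Rightarrow> nat \<Rightarrow> pf" where
  "pf_pow N n x k \<equiv> x [^]\<^bsub>PF N n\<^esub> k"

lemma pf_pow_0: "pf_pow N n x 0 = pf_delta (replicate n 0)"
  by (simp add: nat_pow_def PF_one)

lemma pf_pow_Suc: "pf_pow N n x (Suc k) = pf_mult N n (pf_pow N n x k) x"
  by (simp add: nat_pow_def)

lemma pf_pow_closed: "N > 0 \<Longrightarrow> pf_pow N n x k \<in> carrier (PF N n)"
  by (cases k) (auto simp: PF_one pf_pow_Suc PF_carrier pf_mult_closed pf_delta_def pf_index_zero)

lemma pf_trace_mult:
  "pf_tr n (pf_mult N n x z) = (\<Sum>I\<in>pf_index N n. x I * pf_tr n (pf_mult N n (pf_delta I) z))"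
proof -
  have e: "pf_mult N n x z = pf_mult N n (\<Sum>I\<in>pf_index N n. x I \<cdot>\<^sub>c pf_delta I) z"
    by (subst (2) pf_mult_expand, subst pf_mult_expand, intro sum.cong refl)
      (auto simp: pf_sum_apply pf_scale_def pf_delta_def if_distrib[of "(*) _"] cong: if_cong)
  have "pf_tr n (pf_mult N n (\<Sum>I\<in>pf_index N n. x I \<cdot>\<^sub>c pf_delta I) z) =
      (\<Sum>I\<in>pf_index N n. x I * pf_tr n (pf_mult N n (pf_delta I) z))"
    by (simp only: pf_mult_sum_left pf_mult_scale pf_tr_sum pf_tr_scale)
  then show ?thesis by (simp only: e)
qed

lemma trace_exp_sums:
  assumes "N > 0" "A \<in> carrier (PF N n)"
  shows "(\<lambda>k. pf_tr n (pf_mult N n (pf_pow N n A k) z) / fact k) sums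
    pf_tr n (pf_mult N n (pf_exp N n A) z)"
proof -
  let ?w = "\<lambda>I. pf_tr n (pf_mult N n (pf_delta I) z)"
  have "(\<lambda>k. \<Sum>I\<in>pf_index N n. pf_pow N n A k I / fact k * ?w I) sums
      (\<Sum>I\<in>pf_index N n. pf_exp N n A I * ?w I)"
    by (intro sums_sum sums_mult2 pf_exp_sums assms)
  then show ?thesis
    by (subst (1 2) pf_trace_mult) (simp add: sum_divide_distrib)
qed

lemma trace_pow_bound:
  assumes "N > 0"
  shows "norm (pf_tr n (pf_mult N n (pf_pow N n A k) z)) \<le> pf_l1 N n A ^ k * pf_l1 N n z"
proof -
  have "norm (pf_tr n (pf_mult N n (pf_pow N n A k) z)) \<le> pf_l1 N n (pf_mult N n (pf_pow N n A k) z)"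
    unfolding pf_l1_def pf_tr_def by (intro member_le_sum) (auto simp: pf_index_zero assms)
  also have "\<dots> \<le> pf_l1 N n (pf_pow N n A k) * pf_l1 N n z" by (rule pf_l1_mult)
  also have "\<dots> \<le> pf_l1 N n A ^ k * pf_l1 N n z"
    by (intro mult_right_mono pf_l1_pow assms) (simp add: pf_l1_def sum_nonneg)
  finally show ?thesis .
qed

lemma pf_pow_scale: "pf_pow N n (c \<cdot>\<^sub>c x) k = c ^ k \<cdot>\<^sub>c pf_pow N n x k"
  by (induction k) (simp_all add: pf_pow_0 pf_pow_Suc pf_mult_scale)

lemma pf_scale_closed: "x \<in> carrier (PF N n) \<Longrightarrow> c \<cdot>\<^sub>c x \<in> carrier (PF N n)"
  by (simp add: PF_carrier pf_scale_def)

lemma pf_add_closed: "x \<in> carrier (PF N n) \<Longrightarrow> y \<in> carrier (PF N n) \<Longrightarrow> x + y \<in> carrier (PF N n)"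
  by (simp add: PF_carrier)

lemma pf_one_closed: "N > 0 \<Longrightarrow> pf_delta (replicate n 0) \<in> carrier (PF N n)"
  by (auto simp: PF_carrier pf_delta_def pf_index_zero)

text \<open>Pascal's rule, in the form of the induction step of the binomial theorem for $(A+c)^k$.\<close>

lemma binomial_sum_Suc:
  fixes p :: "nat \<Rightarrow> complex"
  shows "(\<Sum>j\<le>Suc k. of_nat (Suc k choose j) * c ^ (Suc k - j) * p j) =
    (\<Sum>j\<le>k. of_nat (k choose j) * c ^ (k - j) * p (Suc j)) +
    c * (\<Sum>j\<le>k. of_nat (k choose j) * c ^ (k - j) * p j)"
proof -
  have "c * (\<Sum>j\<le>k. of_nat (k choose j) * c ^ (k - j) * p j) =
      (\<Sum>j\<le>k. of_nat (k choose j) * c ^ (Suc k - j) * p j)"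
    unfolding sum_distrib_left by (intro sum.cong refl) (simp add: Suc_diff_le mult_ac)
  also have "\<dots> = (\<Sum>j\<le>Suc k. of_nat (k choose j) * c ^ (Suc k - j) * p j)"
    by simp
  also have "\<dots> = c ^ Suc k * p 0 + (\<Sum>j\<le>k. of_nat (k choose Suc j) * c ^ (k - j) * p (Suc j))"
    by (subst sum.atMost_Suc_shift) simp
  finally show ?thesis
    by (subst sum.atMost_Suc_shift) (simp add: distrib_right sum.distrib)
qed

lemma pf_pow_shift:
  assumes "N > 0" "A \<in> carrier (PF N n)"
  shows "pf_pow N n (A + c \<cdot>\<^sub>c pf_delta (replicate n 0)) k =
    (\<Sum>j\<le>k. (of_nat (k choose j) * c ^ (k - j)) \<cdot>\<^sub>c pf_pow N n A j)"
proof (induction k)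
  case (Suc k)
  let ?P = "\<Sum>j\<le>k. (of_nat (k choose j) * c ^ (k - j)) \<cdot>\<^sub>c pf_pow N n A j"
  have P: "pf_mult N n ?P (pf_delta (replicate n 0)) = ?P"
    unfolding Suc[symmetric] by (intro pf_mult_one(2) pf_pow_closed assms(1))
  have "pf_pow N n (A + c \<cdot>\<^sub>c pf_delta (replicate n 0)) (Suc k) = pf_mult N n ?P A + c \<cdot>\<^sub>c ?P"
    by (simp only: pf_pow_Suc Suc pf_mult_distrib pf_mult_scale P)
  also have "pf_mult N n ?P A = (\<Sum>j\<le>k. (of_nat (k choose j) * c ^ (k - j)) \<cdot>\<^sub>c pf_pow N n A (Suc j))"
    by (simp only: pf_mult_sum_left pf_mult_scale pf_pow_Suc)
  also have "\<dots> + c \<cdot>\<^sub>c ?P =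
      (\<Sum>j\<le>Suc k. (of_nat (Suc k choose j) * c ^ (Suc k - j)) \<cdot>\<^sub>c pf_pow N n A j)"
  proof
    fix I
    show "((\<Sum>j\<le>k. (of_nat (k choose j) * c ^ (k - j)) \<cdot>\<^sub>c pf_pow N n A (Suc j)) + c \<cdot>\<^sub>c ?P) I =
      (\<Sum>j\<le>Suc k. (of_nat (Suc k choose j) * c ^ (Suc k - j)) \<cdot>\<^sub>c pf_pow N n A j) I"
      using binomial_sum_Suc[of k c "\<lambda>j. pf_pow N n A j I"]
      by (simp only: pf_sum_apply pf_scale_def plus_fun_apply)
  qed
  finally show ?case .
qed (simp add: pf_pow_0)

text \<open>Scalars commute with everything, so $e^{A+c} = e^c e^A$. Read through the trace against \<open>z\<close>, this is
  the Cauchy product of two scalar series.\<close>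

lemma trace_exp_shift:
  assumes N: "N > 0" and A: "A \<in> carrier (PF N n)"
  shows "pf_tr n (pf_mult N n (pf_exp N n (A + c \<cdot>\<^sub>c pf_delta (replicate n 0))) z) =
    exp c * pf_tr n (pf_mult N n (pf_exp N n A) z)"
proof -
  let ?a = "\<lambda>k. pf_tr n (pf_mult N n (pf_pow N n A k) z) / fact k"
  let ?b = "\<lambda>k. c ^ k /\<^sub>R fact k"
  have "norm (?a k) \<le> (inverse (fact k) * pf_l1 N n A ^ k) * pf_l1 N n z" for k
    using trace_pow_bound[OF N, of n A k z] by (simp add: norm_divide divide_simps)
  then have a: "summable (\<lambda>k. norm (?a k))"
    by (intro summable_comparison_test'[OF summable_mult2[OF summable_exp], where N = 0]) auto
  have b: "summable (\<lambda>k. norm (?b k))" by (rule summable_norm_exp)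
  have "(\<lambda>k. \<Sum>j\<le>k. ?a j * ?b (k - j)) sums ((\<Sum>k. ?a k) * (\<Sum>k. ?b k))"
    by (rule Cauchy_product_sums[OF a b])
  moreover have "(\<Sum>k. ?a k) = pf_tr n (pf_mult N n (pf_exp N n A) z)"
    using trace_exp_sums[OF N A] by (rule sums_unique[symmetric])
  moreover have "(\<Sum>k. ?b k) = exp c" by (simp add: exp_def)
  moreover have "(\<Sum>j\<le>k. ?a j * ?b (k - j)) =
     pf_tr n (pf_mult N n (pf_pow N n (A + c \<cdot>\<^sub>c pf_delta (replicate n 0)) k) z) / fact k" for k
    unfolding pf_pow_shift[OF N A] pf_mult_sum_left pf_mult_scale pf_tr_sum pf_tr_scale sum_divide_distrib
    by (intro sum.cong refl)
      (simp add: binomial_fact field_simps scaleR_conv_of_real)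
  ultimately have 1: "(\<lambda>k. pf_tr n (pf_mult N n (pf_pow N n (A + c \<cdot>\<^sub>c pf_delta (replicate n 0)) k) z) / fact k)
      sums (pf_tr n (pf_mult N n (pf_exp N n A) z) * exp c)" by simp
  have 2: "(\<lambda>k. pf_tr n (pf_mult N n (pf_pow N n (A + c \<cdot>\<^sub>c pf_delta (replicate n 0)) k) z) / fact k)
      sums pf_tr n (pf_mult N n (pf_exp N n (A + c \<cdot>\<^sub>c pf_delta (replicate n 0))) z)"
    by (intro trace_exp_sums pf_add_closed pf_scale_closed pf_one_closed N A)
  show ?thesis using sums_unique2[OF 2 1] by (simp only: mult.commute)
qed

lemma pf_pow_tendsto:
  assumes "r \<longlonglongrightarrow> (0 :: complex)"
  shows "(\<lambda>i. pf_pow N n (A + r i \<cdot>\<^sub>c B) k I) \<longlonglongrightarrow> pf_pow N n A k I"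
proof (induction k arbitrary: I)
  case (Suc k)
  have 1: "(\<lambda>i. A J + (r i \<cdot>\<^sub>c B) J) \<longlonglongrightarrow> A J" for J
    using tendsto_add[OF tendsto_const[of "A J"] tendsto_mult[OF assms tendsto_const[of "B J"]]]
    by (simp add: pf_scale_def)
  show ?case
    unfolding pf_pow_Suc pf_mult_apply
    by (intro tendsto_sum) (auto intro!: tendsto_mult Suc 1 tendsto_const)
qed (simp add: pf_pow_0)

text \<open>Each term of the exponential series is continuous in the perturbation, and the $\ell^1$ norm
  dominates all the series by one exponential series, so limit and sum may be interchanged.\<close>

lemma trace_exp_tendsto:
  assumes N: "N > 0" and A: "A \<in> carrier (PF N n)" and B: "B \<in> carrier (PF N n)"
    and r: "r \<longlonglongrightarrow> (0 :: complex)" and r1: "\<And>i. norm (r i) \<le> 1"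
  shows "(\<lambda>i. pf_tr n (pf_mult N n (pf_exp N n (A + r i \<cdot>\<^sub>c B)) z)) \<longlonglongrightarrow>
    pf_tr n (pf_mult N n (pf_exp N n A) z)"
proof -
  let ?L = "pf_l1 N n A + pf_l1 N n B"
  let ?f = "\<lambda>k i. pf_tr n (pf_mult N n (pf_pow N n (A + r i \<cdot>\<^sub>c B) k) z) / fact k"
  let ?g = "\<lambda>k. pf_tr n (pf_mult N n (pf_pow N n A k) z) / fact k"
  have lim: "(\<lambda>i. ?f k i) \<longlonglongrightarrow> ?g k" for k
  proof (intro tendsto_divide tendsto_const)
    show "(\<lambda>i. pf_tr n (pf_mult N n (pf_pow N n (A + r i \<cdot>\<^sub>c B) k) z)) \<longlonglongrightarrow>
        pf_tr n (pf_mult N n (pf_pow N n A k) z)"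
      by (subst (1 2) pf_trace_mult) (intro tendsto_sum tendsto_mult tendsto_const pf_pow_tendsto r)
  qed simp
  have l1: "pf_l1 N n (A + r i \<cdot>\<^sub>c B) \<le> ?L" for i
  proof -
    have "pf_l1 N n (A + r i \<cdot>\<^sub>c B) \<le> (\<Sum>I\<in>pf_index N n. norm (A I) + norm (B I))"
      unfolding pf_l1_def
    proof (intro sum_mono)
      fix I
      have "norm ((A + r i \<cdot>\<^sub>c B) I) \<le> norm (A I) + norm (r i) * norm (B I)"
        using norm_triangle_ineq[of "A I" "r i * B I"] by (simp add: pf_scale_def norm_mult)
      also have "\<dots> \<le> norm (A I) + norm (B I)"
        using r1[of i] by (simp add: mult_left_le_one_le)
      finally show "norm ((A + r i \<cdot>\<^sub>c B) I) \<le> norm (A I) + norm (B I)" .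
    qed
    then show ?thesis by (simp add: pf_l1_def sum.distrib)
  qed
  have l0: "pf_l1 N n y \<ge> 0" for y by (simp add: pf_l1_def sum_nonneg)
  have bound: "norm (?f k i) \<le> (inverse (fact k) * ?L ^ k) * pf_l1 N n z" for k i
  proof -
    have "norm (pf_tr n (pf_mult N n (pf_pow N n (A + r i \<cdot>\<^sub>c B) k) z)) \<le> ?L ^ k * pf_l1 N n z"
      using trace_pow_bound[OF N, of n "A + r i \<cdot>\<^sub>c B" k z] l1[of i] l0
      by (meson mult_right_mono order_trans power_mono)
    then show ?thesis by (simp add: norm_divide divide_simps)
  qed
  have "(\<lambda>i. suminf (\<lambda>k. ?f k i)) \<longlonglongrightarrow> suminf ?g"
  proof (rule tannerys_theorem[THEN conjunct2, THEN conjunct2])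
    show "\<forall>\<^sub>F (k, i) in sequentially \<times>\<^sub>F sequentially.
        norm (?f k i) \<le> (inverse (fact k) * ?L ^ k) * pf_l1 N n z"
      by (rule always_eventually) (use bound in blast)
    show "summable (\<lambda>k. (inverse (fact k) * ?L ^ k) * pf_l1 N n z)"
      by (intro summable_mult2 summable_exp)
  qed (rule lim, simp)
  moreover have "suminf (\<lambda>k. ?f k i) = pf_tr n (pf_mult N n (pf_exp N n (A + r i \<cdot>\<^sub>c B)) z)" for i
    by (intro sums_unique[symmetric] trace_exp_sums N pf_add_closed pf_scale_closed A B)
  moreover have "suminf ?g = pf_tr n (pf_mult N n (pf_exp N n A) z)"
    by (intro sums_unique[symmetric] trace_exp_sums N A)
  ultimately show ?thesis by simp
qed

text \<open>The function $\beta\mapsto\mathrm{tr}(e^{\beta A}z)$ is an entire power series with constant term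
  $\mathrm{tr}(z) = 0$, so its linear coefficient is the limit of nonnegative difference quotients.\<close>

lemma trace_exp_first_order:
  assumes N: "N > 0" and A: "A \<in> carrier (PF N n)" and z: "z \<in> carrier (PF N n)" "pf_tr n z = 0"
    and nonneg: "\<And>\<beta> :: real. \<beta> \<ge> 0 \<Longrightarrow>
      pf_tr n (pf_mult N n (pf_exp N n (of_real \<beta> \<cdot>\<^sub>c A)) z) \<in> \<real>\<^sub>\<ge>\<^sub>0"
  shows "pf_tr n (pf_mult N n A z) \<in> \<real>\<^sub>\<ge>\<^sub>0"
proof -
  define a where "a k = pf_tr n (pf_mult N n (pf_pow N n A k) z) / fact k" for k
  define f where "f c = pf_tr n (pf_mult N n (pf_exp N n (c \<cdot>\<^sub>c A)) z)" for c
  have f: "(\<lambda>k. a k * c ^ k) sums f c" for c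
  proof -
    have "pf_tr n (pf_mult N n (pf_pow N n (c \<cdot>\<^sub>c A) k) z) / fact k = a k * c ^ k" for k
      by (simp add: pf_pow_scale pf_mult_scale pf_tr_scale a_def)
    then show ?thesis
      using trace_exp_sums[OF N pf_scale_closed[OF A], of c z] by (simp only: f_def)
  qed
  have a0: "a 0 = 0" by (simp add: a_def PF_one pf_mult_one(1)[OF N z(1)] z(2))
  have a1: "a 1 = pf_tr n (pf_mult N n A z)"
    unfolding a_def One_nat_def pf_pow_Suc pf_pow_0 pf_mult_one(1)[OF N A] by simp
  have "(\<lambda>k. a (Suc k) * c ^ k) sums (f c / c)" if "c \<noteq> 0" for c
  proof -
    have "(\<lambda>k. a (Suc k) * c ^ Suc k) sums f c"
      using sums_Suc_iff[of "\<lambda>k. a k * c ^ k" "f c"] f[of c] a0 by simp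
    from sums_divide[OF this, of c] show ?thesis using that by (simp add: mult.assoc)
  qed
  then have lim: "(\<lambda>c. f c / c) \<midarrow>0\<rightarrow> a 1"
    unfolding One_nat_def
    by (intro powser_limit_0_strong[of 1 "\<lambda>k. a (Suc k)"]) auto
  have "(\<lambda>i. complex_of_real (inverse (real (Suc i)))) \<longlonglongrightarrow> of_real 0"
    by (intro tendsto_of_real LIMSEQ_inverse_real_of_nat)
  then have "filterlim (\<lambda>i. complex_of_real (inverse (real (Suc i)))) (at 0) sequentially"
    by (intro filterlim_atI) (auto simp del: of_nat_Suc)
  from filterlim_compose[OF lim this]
  have l: "(\<lambda>i. f (of_real (inverse (real (Suc i)))) / of_real (inverse (real (Suc i)))) \<longlonglongrightarrow> a 1" .
  have "f (of_real t) / of_real t \<in> \<real>\<^sub>\<ge>\<^sub>0" if "t > 0" for t :: real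
    unfolding f_def using that by (intro nonneg_Reals_divide_I nonneg) auto
  then have "f (of_real (inverse (real (Suc i)))) / of_real (inverse (real (Suc i))) \<in> \<real>\<^sub>\<ge>\<^sub>0" for i
    by (simp only: inverse_positive_iff_positive of_nat_0_less_iff zero_less_Suc)
  then have "a 1 \<in> \<real>\<^sub>\<ge>\<^sub>0"
    using l by (rule closed_sequentially[OF closed_nonneg_Reals_complex])
  then show ?thesis by (simp only: a1)
qed

section \<open>Positive semi-definite matrices as sums of squares\<close>

lemma psd_on_diag:
  assumes "finite S" "psd_on S A" "i \<in> S"
  shows "A i i \<in> \<real>\<^sub>\<ge>\<^sub>0"
proof -
  let ?v = "\<lambda>k. if k = i then 1 else 0 :: complex"
  have "(\<Sum>k\<in>S. \<Sum>l\<in>S. cnj (?v k) * A k l * ?v l) = (\<Sum>k\<in>S. if k = i then A i i else 0)"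
  proof (intro sum.cong refl)
    fix k
    have "(\<Sum>l\<in>S. cnj (?v k) * A k l * ?v l) = (\<Sum>l\<in>S. if l = i then cnj (?v k) * A k i else 0)"
      by (intro sum.cong) auto
    then show "(\<Sum>l\<in>S. cnj (?v k) * A k l * ?v l) = (if k = i then A i i else 0)"
      using assms by simp
  qed
  also have "\<dots> = A i i" using assms by simp
  finally show ?thesis
    using assms(2)[unfolded psd_on_def, rule_format, of ?v] by (simp only:)
qed

lemma psd_on_subset:
  assumes "finite S" "psd_on S A" "R \<subseteq> S"
  shows "psd_on R A"
  unfolding psd_on_def
proof
  fix v :: "_ \<Rightarrow> complex"
  let ?v = "\<lambda>k. if k \<in> R then v k else 0"
  have "(\<Sum>k\<in>S. \<Sum>l\<in>S. cnj (?v k) * A k l * ?v l) = (\<Sum>k\<in>R. \<Sum>l\<in>S. cnj (?v k) * A k l * ?v l)"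
    using assms by (intro sum.mono_neutral_right) auto
  also have "\<dots> = (\<Sum>k\<in>R. \<Sum>l\<in>R. cnj (v k) * A k l * v l)"
    using assms by (intro sum.cong sum.mono_neutral_cong_right refl) auto
  finally show "(\<Sum>k\<in>R. \<Sum>l\<in>R. cnj (v k) * A k l * v l) \<in> \<real>\<^sub>\<ge>\<^sub>0"
    using assms(2)[unfolded psd_on_def, rule_format, of ?v] by (simp only:)
qed

text \<open>Restricting the quadratic form to two coordinates is all that is needed to read off the
  symmetry of the matrix.\<close>

lemma psd_on_pair:
  assumes "finite S" "psd_on S A" "i \<in> S" "j \<in> S" "i \<noteq> j"
  shows "cnj x * A i i * x + cnj x * A i j * y + (cnj y * A j i * x + cnj y * A j j * y) \<in> \<real>\<^sub>\<ge>\<^sub>0"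
proof -
  have "psd_on {i, j} A" using assms by (intro psd_on_subset[OF assms(1,2)]) auto
  then have "(\<Sum>k\<in>{i, j}. \<Sum>l\<in>{i, j}. cnj (if k = i then x else y) * A k l * (if l = i then x else y)) \<in> \<real>\<^sub>\<ge>\<^sub>0"
    unfolding psd_on_def by (rule spec)
  then show ?thesis using assms(5) by auto
qed

lemma psd_on_hermitian:
  assumes "finite S" "psd_on S A" "i \<in> S" "j \<in> S"
  shows "A j i = cnj (A i j)"
proof (cases "i = j")
  case True
  then show ?thesis using psd_on_diag[OF assms(1,2,3)] by (auto simp: complex_nonneg_Reals_iff complex_eq_iff)
next
  case False
  have d: "Im (A i i) = 0" "Im (A j j) = 0"
    using psd_on_diag[OF assms(1,2)] assms(3,4) by (auto simp: complex_nonneg_Reals_iff)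
  show ?thesis
    using psd_on_pair[OF assms False, of 1 1] psd_on_pair[OF assms False, of 1 \<i>] d
    by (auto simp: complex_nonneg_Reals_iff complex_eq_iff)
qed

text \<open>If the diagonal entry vanishes, the form at $(-rb, 1)$ with $b = A_{ij}$ is $A_{jj} - 2r|b|^2$, which
  would be negative for large $r$ unless $b=0$.\<close>

lemma psd_on_zero_diag:
  assumes "finite S" "psd_on S A" "i \<in> S" "j \<in> S" "A i i = 0"
  shows "A i j = 0"
proof (cases "i = j")
  case False
  define b where "b = A i j"
  have ji: "A j i = cnj b" unfolding b_def by (rule psd_on_hermitian[OF assms(1-4)])
  have n: "b * cnj b = of_real ((cmod b)\<^sup>2)" by (rule complex_norm_square[symmetric])
  have *: "Re (A j j) - 2 * r * (cmod b)\<^sup>2 \<ge> 0" for r :: real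
  proof -
    let ?x = "- of_real r * b"
    have "cnj ?x * A i i * ?x + cnj ?x * A i j * 1 + (cnj 1 * A j i * ?x + cnj 1 * A j j * 1) =
        A j j - 2 * of_real r * (b * cnj b)"
      by (simp add: ji b_def[symmetric] assms(5) algebra_simps)
    then have "A j j - 2 * of_real r * (b * cnj b) \<in> \<real>\<^sub>\<ge>\<^sub>0"
      using psd_on_pair[OF assms(1-4) False, of ?x 1] by (simp only:)
    then show ?thesis unfolding n by (simp add: complex_nonneg_Reals_iff)
  qed
  have "cmod b = 0"
  proof (rule ccontr)
    assume "cmod b \<noteq> 0"
    then show False using *[of "(Re (A j j) + 1) / (2 * (cmod b)\<^sup>2)"] by simp
  qed
  then show ?thesis by (simp add: b_def)
qed (use assms in simp)

text \<open>The form of the Schur complement at $v$ is the minimum of the form of $A$ over all extensions of $v$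
  to the coordinate $a$, attained at the value $-s/A_{aa}$ used for \<open>w\<close>. If $A_{aa}=0$, then the whole
  row vanishes, and division by zero yields the correct result.\<close>

lemma psd_on_schur_complement:
  assumes S: "finite S" "a \<notin> S" and psd: "psd_on (insert a S) A"
  shows "psd_on S (\<lambda>i j. A i j - A i a * A a j / A a a)"
  unfolding psd_on_def
proof
  fix v :: "_ \<Rightarrow> complex"
  let ?Q = "\<Sum>i\<in>S. \<Sum>j\<in>S. cnj (v i) * A i j * v j"
  define s where "s = (\<Sum>j\<in>S. A a j * v j)"
  define w where "w = (\<lambda>k. if k = a then - s / A a a else v k)"
  have fin: "finite (insert a S)" using S by simp
  have herm: "A i a = cnj (A a i)" if "i \<in> S" for i
    using that by (intro psd_on_hermitian[OF fin psd]) auto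
  have cs: "(\<Sum>i\<in>S. cnj (v i) * A i a) = cnj s"
    unfolding s_def cnj_sum by (intro sum.cong refl) (simp only: herm complex_cnj_mult mult.commute)
  have s0: "s = 0" if "A a a = 0"
    unfolding s_def using psd_on_zero_diag[OF fin psd, of a] that by (intro sum.neutral) auto
  have wS: "w i = v i" if "i \<in> S" for i using that S by (auto simp: w_def)
  have "(\<Sum>i\<in>insert a S. \<Sum>j\<in>insert a S. cnj (w i) * A i j * w j) =
     cnj (w a) * A a a * w a + cnj (w a) * s + (cnj s * w a + ?Q)"
  proof -
    define R where "R i = (\<Sum>j\<in>S. A i j * v j)" for i
    have "(\<Sum>j\<in>insert a S. cnj (w i) * A i j * w j) = cnj (w i) * (A i a * w a + R i)" for i
      using S wS by (simp add: R_def sum_distrib_left distrib_left mult.assoc)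
    then have "(\<Sum>i\<in>insert a S. \<Sum>j\<in>insert a S. cnj (w i) * A i j * w j) =
        cnj (w a) * (A a a * w a + R a) + (\<Sum>i\<in>S. cnj (v i) * (A i a * w a + R i))"
      using S wS by simp
    also have "(\<Sum>i\<in>S. cnj (v i) * (A i a * w a + R i)) =
        (\<Sum>i\<in>S. cnj (v i) * A i a) * w a + (\<Sum>i\<in>S. cnj (v i) * R i)"
      by (simp only: sum_distrib_right sum.distrib distrib_left mult.assoc)
    also have "(\<Sum>i\<in>S. cnj (v i) * R i) = ?Q"
      by (simp only: R_def sum_distrib_left mult.assoc)
    finally show ?thesis by (simp only: cs R_def s_def distrib_left mult.assoc)
  qed
  also have "\<dots> = ?Q - cnj s * s / A a a"
    using s0 psd_on_hermitian[OF fin psd, of a a, simplified, symmetric]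
    by (cases "A a a = 0") (simp_all add: w_def field_simps)
  also have "cnj s * s / A a a = (\<Sum>i\<in>S. \<Sum>j\<in>S. cnj (v i) * (A i a * A a j / A a a) * v j)"
    unfolding cs[symmetric] unfolding s_def
    by (simp add: sum_product sum_divide_distrib) (simp add: mult_ac)
  also have "?Q - \<dots> = (\<Sum>i\<in>S. \<Sum>j\<in>S. cnj (v i) * (A i j - A i a * A a j / A a a) * v j)"
    by (simp add: algebra_simps flip: sum_subtractf)
  finally show "(\<Sum>i\<in>S. \<Sum>j\<in>S. cnj (v i) * (A i j - A i a * A a j / A a a) * v j) \<in> \<real>\<^sub>\<ge>\<^sub>0"
    using psd[unfolded psd_on_def, rule_format, of w] by (simp only:)
qed

text \<open>Cholesky decomposition: split off the rank one matrix of a row and continue with the Schur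
  complement.\<close>

theorem psd_on_sum_of_squares:
  assumes "finite S" "psd_on S A"
  obtains v where "\<And>i j. i \<in> S \<Longrightarrow> j \<in> S \<Longrightarrow> A i j = (\<Sum>k\<in>S. cnj (v k i) * v k j)"
proof -
  have "\<exists>v. \<forall>i\<in>S. \<forall>j\<in>S. A i j = (\<Sum>k\<in>S. cnj (v k i) * v k j)"
    using assms
  proof (induction S arbitrary: A rule: finite_induct)
    case (insert a S)
    have fin: "finite (insert a S)" using insert by simp
    obtain u where u: "A i j - A i a * A a j / A a a = (\<Sum>k\<in>S. cnj (u k i) * u k j)"
      if "i \<in> S" "j \<in> S" for i j
      using insert.IH[OF psd_on_schur_complement[OF insert.hyps insert.prems]] by blast
    define r where "r = sqrt (Re (A a a))"
    have rr: "of_real r * of_real r = A a a"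
      using psd_on_diag[OF fin insert.prems, of a]
      by (auto simp: r_def complex_nonneg_Reals_iff complex_eq_iff)
    have herm: "A i a = cnj (A a i)" if "i \<in> insert a S" for i
      using that by (intro psd_on_hermitian[OF fin insert.prems]) auto
    have A0: "A a j = 0" if "A a a = 0" "j \<in> insert a S" for j
      using psd_on_zero_diag[OF fin insert.prems, of a j] that by auto
    define v where "v = (\<lambda>k j. if k = a then A a j / of_real r else if j = a then 0 else u k j)"
    have "A i j = (\<Sum>k\<in>insert a S. cnj (v k i) * v k j)" if ij: "i \<in> insert a S" "j \<in> insert a S" for i j
    proof -
      have "(\<Sum>k\<in>insert a S. cnj (v k i) * v k j) =
        A i a * A a j / A a a + (\<Sum>k\<in>S. cnj (v k i) * v k j)"
        using insert.hyps herm[OF ij(1)] by (simp add: v_def rr)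
      also have "(\<Sum>k\<in>S. cnj (v k i) * v k j) =
          (if i = a \<or> j = a then 0 else A i j - A i a * A a j / A a a)"
      proof (cases "i = a \<or> j = a")
        case True
        then show ?thesis using insert.hyps by (auto simp: v_def intro!: sum.neutral)
      next
        case False
        then show ?thesis using insert.hyps ij u[of i j]
          by (auto simp: v_def intro!: sum.cong)
      qed
      also have "A i a * A a j / A a a + \<dots> = A i j"
        using A0[OF _ ij(2)] A0[OF _ ij(1)] herm[OF ij(1)] by (cases "A a a = 0") auto
      finally show ?thesis by simp
    qed
    then show ?case by blast
  qed simp
  then show ?thesis using that by blast
qed

section \<open>The twisted tensor product\<close>

text \<open>In the notation below \<open>T x y\<close> is $\Theta(x)\otimes_t y$, and the
  two products are those of $PF_m$ and of the double $PF_{2m}$.\<close>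

locale parafermion_double =
  fixes N m :: nat and \<zeta> :: complex
  assumes N2: "N \<ge> 2" and zeta_sq: "\<zeta>\<^sup>2 = pf_q N" and zeta_N2: "\<zeta> ^ (N\<^sup>2) = 1"
begin

abbreviation X where "X \<equiv> pf_index N m"
abbreviation zero_index (\<open>\<o>\<close>) where "\<o> \<equiv> replicate m 0"
abbreviation gr where "gr I \<equiv> sum_list I mod N"
abbreviation T where "T \<equiv> pf_Theta_twist \<zeta> N m"
abbreviation mul (infixl \<open>\<bullet>\<^sub>m\<close> 70) where "x \<bullet>\<^sub>m y \<equiv> pf_mult N m x y"
abbreviation Mul (infixl \<open>\<bullet>\<^sub>2\<close> 70) where "x \<bullet>\<^sub>2 y \<equiv> pf_mult N (2 * m) x y"
abbreviation ph where "ph \<equiv> pf_phase N"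
abbreviation iadd (infixl \<open>\<oplus>\<^sub>N\<close> 65) where "I \<oplus>\<^sub>N J \<equiv> pf_index_add N I J"

text \<open>The normal form of $\Theta(C_I)\otimes_t C_J$ in the basis of $PF_{2m}$; its coefficient has
  modulus one.\<close>

definition twist_basis :: "nat list \<Rightarrow> nat list \<Rightarrow> pf" where
  "twist_basis I J = (\<zeta> ^ (gr I * gr J) * ph I I) \<cdot>\<^sub>c pf_delta (pf_reflect N I @ J)"

lemma N0: "N > 0"
  using N2 by simp

lemma pf_minus_combination:
  assumes "finite A" "\<And>a. a \<in> A \<Longrightarrow> f a \<in> X"
  shows "pf_minus N m (\<Sum>a\<in>A. s a \<cdot>\<^sub>c pf_delta (f a)) = (\<Sum>a\<in>A. s a \<cdot>\<^sub>c pf_delta (f a @ \<o>))"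
proof -
  have "pf_minus N m y = (\<Sum>I\<in>X. y I \<cdot>\<^sub>c pf_delta (I @ \<o>))" for y
    unfolding pf_minus_def
    by (intro sum.cong refl) (simp add: pf_C_eq_delta N2 pf_index_append pf_index_zero N0)
  then show ?thesis using assms by (simp only: pf_linear_subst)
qed

text \<open>An element of $A_-$ times an element of $A_+$ is already ordered, so no phase arises.\<close>

lemma pf_tensor_Theta:
  "pf_tensor N m (pf_Theta N m x) y =
    (\<Sum>I\<in>X. \<Sum>J\<in>X. (cnj (x I) * y J * ph I I) \<cdot>\<^sub>c pf_delta (pf_reflect N I @ J))"
proof -
  have "pf_Theta N m x = (\<Sum>I\<in>X. (cnj (x I) * ph I I) \<cdot>\<^sub>c pf_delta (pf_reflect N I))"
    unfolding pf_Theta_def by (intro sum.cong refl) (simp add: pf_Theta_C_eq N2)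
  then have 1: "pf_minus N m (pf_Theta N m x) =
      (\<Sum>I\<in>X. (cnj (x I) * ph I I) \<cdot>\<^sub>c pf_delta (pf_reflect N I @ \<o>))"
    by (simp add: pf_minus_combination pf_reflect_closed N0)
  have 2: "pf_sigma N m y = (\<Sum>J\<in>X. y J \<cdot>\<^sub>c pf_delta (\<o> @ J))"
    unfolding pf_sigma_def
    by (intro sum.cong refl) (simp add: pf_C_eq_delta N2 pf_index_append pf_index_zero N0)
  have 3: "pf_delta (K @ \<o>) \<bullet>\<^sub>2 pf_delta (\<o> @ J) = pf_delta (K @ J)" if "K \<in> X" "J \<in> X" for K J
    using that
    by (subst pf_delta_mult)
      (simp_all add: pf_index_append pf_index_zero N0 pf_phase_append pf_index_add_append
        pf_index_length pf_index_add_zero sum_list_replicate)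
  show ?thesis
    unfolding pf_tensor_def 1 2 PF_mult pf_mult_sum_left
    unfolding pf_mult_sum_right
    by (intro sum.cong refl) (simp add: pf_mult_scale 3 pf_reflect_closed N0, simp add: mult_ac)
qed

lemma twist_expand: "T x y = (\<Sum>I\<in>X. \<Sum>J\<in>X. (cnj (x I) * y J) \<cdot>\<^sub>c twist_basis I J)"
proof -
  let ?c = "\<lambda>i j I J. if gr I = i then if gr J = j then \<zeta> ^ (i * j) * (cnj (x I) * y J * ph I I) else 0 else 0"
  have "T x y = (\<Sum>i<N. \<Sum>j<N. \<Sum>I\<in>X. \<Sum>J\<in>X. ?c i j I J \<cdot>\<^sub>c pf_delta (pf_reflect N I @ J))"
    unfolding pf_Theta_twist_def pf_tensor_Theta pf_scale_sum
    by (intro sum.cong refl) (simp add: pf_component_def)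
  also have "\<dots> = (\<Sum>I\<in>X. \<Sum>J\<in>X. \<Sum>i<N. \<Sum>j<N. ?c i j I J \<cdot>\<^sub>c pf_delta (pf_reflect N I @ J))"
    by (rule sum_swap_pairs)
  also have "\<dots> = (\<Sum>I\<in>X. \<Sum>J\<in>X. (\<Sum>i<N. \<Sum>j<N. ?c i j I J) \<cdot>\<^sub>c pf_delta (pf_reflect N I @ J))"
    by (simp only: pf_sum_scale)
  also have "\<dots> = (\<Sum>I\<in>X. \<Sum>J\<in>X. (cnj (x I) * y J) \<cdot>\<^sub>c twist_basis I J)"
  proof (intro sum.cong refl)
    fix I J
    have "(\<Sum>i<N. \<Sum>j<N. ?c i j I J) =
       (\<Sum>i<N. if gr I = i then \<Sum>j<N. if gr J = j then \<zeta> ^ (i * j) * (cnj (x I) * y J * ph I I) else 0 else 0)"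
      by (intro sum.cong) auto
    also have "\<dots> = \<zeta> ^ (gr I * gr J) * (cnj (x I) * y J * ph I I)"
      using N0 by simp
    finally have "(\<Sum>i<N. \<Sum>j<N. ?c i j I J) = \<zeta> ^ (gr I * gr J) * (cnj (x I) * y J * ph I I)" .
    then show "(\<Sum>i<N. \<Sum>j<N. ?c i j I J) \<cdot>\<^sub>c pf_delta (pf_reflect N I @ J) =
        (cnj (x I) * y J) \<cdot>\<^sub>c twist_basis I J"
      by (simp add: twist_basis_def mult_ac)
  qed
  finally show ?thesis .
qed

lemma twist_combination:
  assumes "finite A" "\<And>a. a \<in> A \<Longrightarrow> f a \<in> X" "finite B" "\<And>b. b \<in> B \<Longrightarrow> g b \<in> X"
  shows "T (\<Sum>a\<in>A. s a \<cdot>\<^sub>c pf_delta (f a)) (\<Sum>b\<in>B. r b \<cdot>\<^sub>c pf_delta (g b)) =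
    (\<Sum>a\<in>A. \<Sum>b\<in>B. (cnj (s a) * r b) \<cdot>\<^sub>c twist_basis (f a) (g b))"
proof -
  have "T x y = (\<Sum>I\<in>X. cnj (x I) \<cdot>\<^sub>c (\<Sum>J\<in>X. y J \<cdot>\<^sub>c twist_basis I J))" for x y
    by (simp add: twist_expand pf_scale_sum)
  then have "T (\<Sum>a\<in>A. s a \<cdot>\<^sub>c pf_delta (f a)) (\<Sum>b\<in>B. r b \<cdot>\<^sub>c pf_delta (g b)) =
     (\<Sum>a\<in>A. cnj (s a) \<cdot>\<^sub>c (\<Sum>b\<in>B. r b \<cdot>\<^sub>c twist_basis (f a) (g b)))"
    using assms by (simp only: pf_antilinear_subst pf_linear_subst)
  then show ?thesis by (simp add: pf_scale_sum)
qed

lemma twist_C: "I \<in> X \<Longrightarrow> J \<in> X \<Longrightarrow> T (pf_C N m I) (pf_C N m J) = twist_basis I J"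
  using twist_combination[of "{()}" "\<lambda>_. I" "{()}" "\<lambda>_. J" "\<lambda>_. 1" "\<lambda>_. 1"]
  by (simp add: pf_C_eq_delta N2)

text \<open>This is where $\zeta^{N^2}=1$ enters: $(r+Nk)^2 = r^2 + 2N\,rk + N^2k^2$, with $\zeta^{2N} = q^N = 1$.\<close>

lemma zeta_mod_square: "\<zeta> ^ ((a mod N)\<^sup>2) = \<zeta> ^ (a\<^sup>2)"
proof -
  define r k where "r = a mod N" and "k = a div N"
  have "a = r + N * k" by (simp add: r_def k_def)
  then have "a\<^sup>2 = r\<^sup>2 + 2 * N * (r * k) + N\<^sup>2 * k\<^sup>2"
    by (simp add: power2_eq_square algebra_simps)
  moreover have "\<zeta> ^ (2 * N) = 1"
    by (simp add: power_mult zeta_sq pf_q_power N0)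
  ultimately have "\<zeta> ^ (a\<^sup>2) = \<zeta> ^ (r\<^sup>2)"
    by (simp only: power_add power_mult[of _ "2 * N"] power_mult[of _ "N\<^sup>2"] zeta_N2 power_one mult_1_right)
  then show ?thesis by (simp add: r_def)
qed

text \<open>The reflection has grading opposite to that of $I$, so moving $C_J$ with $|J|=b$ past $\Theta(C_I)$
  produces $q^{b|I|} = \zeta^{2b|I|}$.\<close>

lemma phase_reflect_grade:
  assumes "I \<in> X"
  shows "inverse (pf_q N) ^ (b * sum_list (pf_reflect N I)) = \<zeta> ^ (2 * (b mod N * gr I))"
proof -
  let ?w = "inverse (pf_q N)"
  have "N dvd sum_list (pf_reflect N I) + sum_list I"
    using assms by (intro pf_grade_reflect) (auto simp: pf_index_def)
  then obtain k where k: "sum_list (pf_reflect N I) + sum_list I = N * k" by auto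
  have "?w ^ (b * sum_list (pf_reflect N I)) * ?w ^ (b * sum_list I) = (?w ^ N) ^ (b * k)"
  proof -
    have "?w ^ (b * sum_list (pf_reflect N I)) * ?w ^ (b * sum_list I) = ?w ^ (b * (N * k))"
      unfolding k[symmetric] by (simp add: distrib_left power_add)
    then show ?thesis by (simp add: mult_ac flip: power_mult)
  qed
  also have "\<dots> = 1" using pf_q_power[OF N0] by (simp add: power_inverse)
  finally have "?w ^ (b * sum_list (pf_reflect N I)) = inverse (?w ^ (b * sum_list I))"
    by (metis inverse_inverse_eq inverse_unique mult.commute)
  also have "?w ^ (b * sum_list I) = ?w ^ (b mod N * gr I)"
    by (simp add: pf_q_mod_mult[OF N0])
  also have "inverse (?w ^ (b mod N * gr I)) = \<zeta> ^ (2 * (b mod N * gr I))"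
    by (simp add: power_mult[of \<zeta> 2] zeta_sq power_inverse)
  finally show ?thesis .
qed

lemma twist_basis_mult:
  assumes X: "I \<in> X" "J \<in> X" "I' \<in> X" "J' \<in> X"
  shows "twist_basis I J \<bullet>\<^sub>2 twist_basis I' J' =
    (\<zeta> ^ (gr I * gr J) * ph I I * (\<zeta> ^ (gr I' * gr J') * ph I' I') *
     (ph I' I * ph J J' * \<zeta> ^ (2 * (gr J * gr I'))))
    \<cdot>\<^sub>c pf_delta (pf_reflect N (I \<oplus>\<^sub>N I') @ (J \<oplus>\<^sub>N J'))"
  using X unfolding twist_basis_def
  by (simp add: pf_mult_scale pf_delta_mult pf_index_append pf_reflect_closed N0 pf_phase_append
      pf_index_length pf_index_add_append phase_reflect_grade pf_phase_reflect[where n = m]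
      pf_reflect_add[where n = m]) (simp add: mult_ac)

text \<open>For equal gradings in each factor the three powers of $\zeta$ combine to the square of the sum of
  the gradings. The phase of $I'$ with $I$ produced by the reflected halves, together with the phases
  of $\Theta(C_I)$ and $\Theta(C_{I'})$, becomes the phase of $\Theta(C_{I+I'})$ up to the conjugate
  phase of $C_IC_{I'}$.\<close>

lemma twist_basis_mult_balanced:
  assumes X: "I \<in> X" "J \<in> X" "I' \<in> X" "J' \<in> X" and g: "gr I = gr J" "gr I' = gr J'"
  shows "twist_basis I J \<bullet>\<^sub>2 twist_basis I' J' =
    (cnj (ph I I') * ph J J') \<cdot>\<^sub>c twist_basis (I \<oplus>\<^sub>N I') (J \<oplus>\<^sub>N J')"
proof -
  have gr: "gr (I \<oplus>\<^sub>N I') = (gr J + gr J') mod N" "gr (J \<oplus>\<^sub>N J') = (gr J + gr J') mod N"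
    using X g by (simp_all add: pf_grade_add pf_index_length mod_add_eq flip: mod_add_eq[of "sum_list I"])
  have z: "\<zeta> ^ (gr (I \<oplus>\<^sub>N I') * gr (J \<oplus>\<^sub>N J')) =
      \<zeta> ^ (gr J * gr J) * \<zeta> ^ (gr J' * gr J') * \<zeta> ^ (2 * (gr J * gr J'))"
  proof -
    have "(gr J + gr J')\<^sup>2 = gr J * gr J + gr J' * gr J' + 2 * (gr J * gr J')"
      by (simp add: power2_eq_square algebra_simps)
    then show ?thesis unfolding gr using zeta_mod_square[of "gr J + gr J'"]
      by (simp add: power2_eq_square power_add)
  qed
  have p: "ph (I \<oplus>\<^sub>N I') (I \<oplus>\<^sub>N I') * cnj (ph I I') = ph I I * ph I' I' * ph I' I"
    using X by (simp add: pf_phase_add[OF N0] pf_index_add_closed N0 cnj_pf_phase)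
  have "(cnj (ph I I') * ph J J') \<cdot>\<^sub>c twist_basis (I \<oplus>\<^sub>N I') (J \<oplus>\<^sub>N J') =
     (\<zeta> ^ (gr (I \<oplus>\<^sub>N I') * gr (J \<oplus>\<^sub>N J')) * (ph (I \<oplus>\<^sub>N I') (I \<oplus>\<^sub>N I') * cnj (ph I I')) * ph J J')
       \<cdot>\<^sub>c pf_delta (pf_reflect N (I \<oplus>\<^sub>N I') @ (J \<oplus>\<^sub>N J'))"
    by (simp add: twist_basis_def mult_ac)
  also have "\<dots> = twist_basis I J \<bullet>\<^sub>2 twist_basis I' J'"
    unfolding z p twist_basis_mult[OF X] using g by (simp add: mult_ac)
  finally show ?thesis by simp
qed

lemma twist_mult_expand:
  "T x y \<bullet>\<^sub>2 T x' y' = (\<Sum>I\<in>X. \<Sum>J\<in>X. \<Sum>I'\<in>X. \<Sum>J'\<in>X.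
     (cnj (x I) * y J * (cnj (x' I') * y' J')) \<cdot>\<^sub>c (twist_basis I J \<bullet>\<^sub>2 twist_basis I' J'))"
  unfolding twist_expand pf_mult_sum_left
  unfolding pf_mult_sum_right
  by (intro sum.cong refl) (simp add: pf_mult_scale, simp add: mult_ac)

lemma grade_nonzero: "pf_has_grading N m d x \<Longrightarrow> x I \<noteq> 0 \<Longrightarrow> gr I = d mod N"
  by (auto simp: pf_has_grading_def)

text \<open>In the expansion over the basis a nonzero coefficient forces equal gradings $|I|=|J|$ and
  $|I'|=|J'|$, so the product formula for balanced basis elements applies to every term.\<close>

theorem twist_mult:
  assumes "pf_has_grading N m d x" "pf_has_grading N m d y"
    "pf_has_grading N m d' x'" "pf_has_grading N m d' y'"
  shows "T x y \<bullet>\<^sub>2 T x' y' = T (x \<bullet>\<^sub>m x') (y \<bullet>\<^sub>m y')"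
proof -
  have pm: "x \<bullet>\<^sub>m y = (\<Sum>p\<in>X \<times> X. (x (fst p) * y (snd p) * ph (fst p) (snd p)) \<cdot>\<^sub>c
      pf_delta (fst p \<oplus>\<^sub>N snd p))" for x y
    unfolding pf_mult_def by (rule sum_pair)
  have "T (x \<bullet>\<^sub>m x') (y \<bullet>\<^sub>m y') = (\<Sum>p\<in>X \<times> X. \<Sum>r\<in>X \<times> X.
      (cnj (x (fst p) * x' (snd p) * ph (fst p) (snd p)) * (y (fst r) * y' (snd r) * ph (fst r) (snd r)))
      \<cdot>\<^sub>c twist_basis (fst p \<oplus>\<^sub>N snd p) (fst r \<oplus>\<^sub>N snd r))"
    unfolding pm by (rule twist_combination) (auto intro!: pf_index_add_closed N0)
  also have "\<dots> = (\<Sum>I\<in>X. \<Sum>I'\<in>X. \<Sum>J\<in>X. \<Sum>J'\<in>X.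
      (cnj (x I * x' I' * ph I I') * (y J * y' J' * ph J J')) \<cdot>\<^sub>c twist_basis (I \<oplus>\<^sub>N I') (J \<oplus>\<^sub>N J'))"
    by (subst (3) sum_pair, subst (2) sum_pair) (rule refl)
  also have "\<dots> = (\<Sum>I\<in>X. \<Sum>J\<in>X. \<Sum>I'\<in>X. \<Sum>J'\<in>X.
      (cnj (x I * x' I' * ph I I') * (y J * y' J' * ph J J')) \<cdot>\<^sub>c twist_basis (I \<oplus>\<^sub>N I') (J \<oplus>\<^sub>N J'))"
    by (rule sum_swap_middle)
  also have "\<dots> = T x y \<bullet>\<^sub>2 T x' y'"
    unfolding twist_mult_expand
  proof (intro sum.cong refl)
    fix I J I' J' assume X: "I \<in> X" "J \<in> X" "I' \<in> X" "J' \<in> X"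
    show "(cnj (x I * x' I' * ph I I') * (y J * y' J' * ph J J')) \<cdot>\<^sub>c twist_basis (I \<oplus>\<^sub>N I') (J \<oplus>\<^sub>N J') =
      (cnj (x I) * y J * (cnj (x' I') * y' J')) \<cdot>\<^sub>c (twist_basis I J \<bullet>\<^sub>2 twist_basis I' J')"
    proof (cases "x I = 0 \<or> y J = 0 \<or> x' I' = 0 \<or> y' J' = 0")
      case False
      then have "gr I = gr J" "gr I' = gr J'"
        using grade_nonzero assms by metis+
      then show ?thesis by (simp add: twist_basis_mult_balanced X) (simp add: mult_ac)
    qed auto
  qed
  finally show ?thesis by simp
qed

lemma grade_add: "I \<in> X \<Longrightarrow> J \<in> X \<Longrightarrow> gr (I \<oplus>\<^sub>N J) = (gr I + gr J) mod N"
  by (simp only: pf_grade_add pf_index_length mod_add_eq)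

text \<open>Balance of the first factor suffices: if the trace is nonzero, then $I'=-I$ and $J'=-J$,
  so the second factor is balanced as well.\<close>

lemma trace_twist_basis_mult:
  assumes X: "I \<in> X" "J \<in> X" "I' \<in> X" "J' \<in> X" and g: "gr I = gr J"
  shows "pf_tr (2 * m) (twist_basis I J \<bullet>\<^sub>2 twist_basis I' J') =
    cnj (pf_tr m (pf_delta I \<bullet>\<^sub>m pf_delta I')) * pf_tr m (pf_delta J \<bullet>\<^sub>m pf_delta J')"
proof -
  have tr: "pf_tr m (pf_delta I \<bullet>\<^sub>m pf_delta I') = (if I \<oplus>\<^sub>N I' = \<o> then ph I I' else 0)"
    if "I \<in> X" "I' \<in> X" for I I'
    using that by (auto simp: pf_delta_mult pf_tr_scale) (auto simp: pf_tr_def pf_delta_def)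
  have zz: "replicate (2 * m) 0 = \<o> @ \<o>" by (simp add: mult_2 replicate_add)
  have trb: "pf_tr (2 * m) (pf_delta (pf_reflect N (I \<oplus>\<^sub>N I') @ (J \<oplus>\<^sub>N J'))) =
      (if I \<oplus>\<^sub>N I' = \<o> \<and> J \<oplus>\<^sub>N J' = \<o> then 1 else 0)"
  proof -
    have c: "I \<oplus>\<^sub>N I' \<in> X" using X by (simp add: pf_index_add_closed N0)
    then have "length (pf_reflect N (I \<oplus>\<^sub>N I')) = length \<o>" by (simp add: pf_index_length)
    then show ?thesis using pf_reflect_eq_zero[OF c N0]
      unfolding pf_tr_def zz pf_delta_def by (auto simp: append_eq_append_conv)
  qed
  show ?thesis
  proof (cases "I \<oplus>\<^sub>N I' = \<o> \<and> J \<oplus>\<^sub>N J' = \<o>")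
    case True
    have "gr \<o> = 0" by (simp add: sum_list_replicate)
    then have "(gr J + gr I') mod N = (gr J + gr J') mod N"
      using grade_add[of I I'] grade_add[of J J'] True X g by argo
    then have "gr I' = gr J'" by (rule mod_add_cancel) (simp_all add: N0)
    then show ?thesis using True X g trb
      by (simp add: twist_basis_mult_balanced tr pf_tr_scale)
        (simp add: twist_basis_def pf_tr_scale sum_list_replicate)
  next
    case False
    then have "pf_tr (2 * m) (twist_basis I J \<bullet>\<^sub>2 twist_basis I' J') = 0"
      unfolding twist_basis_mult[OF X] pf_tr_scale trb by auto
    moreover have "cnj (pf_tr m (pf_delta I \<bullet>\<^sub>m pf_delta I')) * pf_tr m (pf_delta J \<bullet>\<^sub>m pf_delta J') = 0"
      using False X by (auto simp: tr)
    ultimately show ?thesis by simp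
  qed
qed

text \<open>For inhomogeneous \<open>x\<close>, \<open>x'\<close> the element $T(x,x')$ has components of nonzero grading. They
  contribute zero on the left because $T(y,z)$ is neutral, and zero on the right because
  $\mathrm{tr}(yx)$ sees only the component of \<open>x\<close> of grading opposite to that of \<open>y\<close>.\<close>

theorem trace_twist_mult:
  assumes "pf_has_grading N m d y" "pf_has_grading N m d z"
  shows "pf_tr (2 * m) (T y z \<bullet>\<^sub>2 T x x') = cnj (pf_tr m (y \<bullet>\<^sub>m x)) * pf_tr m (z \<bullet>\<^sub>m x')"
proof -
  let ?t = "\<lambda>I J. pf_tr m (pf_delta I \<bullet>\<^sub>m pf_delta J)"
  have tr: "pf_tr m (u \<bullet>\<^sub>m v) = (\<Sum>I\<in>X. \<Sum>J\<in>X. u I * v J * ?t I J)" for u v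
    by (subst pf_mult_expand) (simp add: pf_tr_sum pf_tr_scale)
  have "cnj (pf_tr m (y \<bullet>\<^sub>m x)) * pf_tr m (z \<bullet>\<^sub>m x') =
    (\<Sum>I\<in>X. \<Sum>I'\<in>X. \<Sum>J\<in>X. \<Sum>J'\<in>X. cnj (y I * x I' * ?t I I') * (z J * x' J' * ?t J J'))"
    unfolding tr[of y x] tr[of z x'] cnj_sum by (rule sum_product_pairs[THEN trans]) (simp only: complex_cnj_mult)
  also have "\<dots> = (\<Sum>I\<in>X. \<Sum>J\<in>X. \<Sum>I'\<in>X. \<Sum>J'\<in>X. cnj (y I * x I' * ?t I I') * (z J * x' J' * ?t J J'))"
    by (rule sum_swap_middle)
  also have "\<dots> = pf_tr (2 * m) (T y z \<bullet>\<^sub>2 T x x')"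
    unfolding twist_mult_expand pf_tr_sum
  proof (intro sum.cong refl)
    fix I J I' J' assume X: "I \<in> X" "J \<in> X" "I' \<in> X" "J' \<in> X"
    show "cnj (y I * x I' * ?t I I') * (z J * x' J' * ?t J J') =
      pf_tr (2 * m) ((cnj (y I) * z J * (cnj (x I') * x' J')) \<cdot>\<^sub>c (twist_basis I J \<bullet>\<^sub>2 twist_basis I' J'))"
    proof (cases "y I = 0 \<or> z J = 0")
      case False
      then have "gr I = gr J" using grade_nonzero assms by metis
      then show ?thesis using X by (simp add: pf_tr_scale trace_twist_basis_mult)
    qed (auto simp: pf_tr_scale)
  qed
  finally show ?thesis by simp
qed

lemma twist_add:
  "T (x + y) z = T x z + T y z"
  "T z (x + y) = T z x + T z y"
  by (simp_all only: twist_expand plus_fun_apply complex_cnj_add distrib_left distrib_right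
      pf_add_scale sum.distrib)

lemma twist_scale: "T (c \<cdot>\<^sub>c x) (d \<cdot>\<^sub>c y) = (cnj c * d) \<cdot>\<^sub>c T x y"
  unfolding twist_expand pf_scale_sum
  by (intro sum.cong refl) (simp add: pf_scale_def[of c x] pf_scale_def[of d y] mult_ac)

lemma twist_basis_closed: "I \<in> X \<Longrightarrow> J \<in> X \<Longrightarrow> twist_basis I J \<in> carrier (PF N (2 * m))"
  unfolding twist_basis_def
  by (intro pf_scale_closed) (auto simp: PF_carrier pf_delta_def pf_index_append pf_reflect_closed N0)

lemma twist_closed: "T x y \<in> carrier (PF N (2 * m))"
  using twist_basis_closed
  by (auto simp: twist_expand PF_carrier pf_sum_apply pf_scale_def intro!: sum.neutral)

section \<open>The cone of reflection-positive elements\<close>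

lemma pf_has_grading_mult:
  assumes "pf_has_grading N m d x" "pf_has_grading N m d' y"
  shows "pf_has_grading N m (d + d') (x \<bullet>\<^sub>m y)"
  unfolding pf_has_grading_def
proof (intro conjI allI impI)
  show "x \<bullet>\<^sub>m y \<in> carrier (PF N m)" by (simp add: PF_carrier pf_mult_closed N0)
  fix K assume "(x \<bullet>\<^sub>m y) K \<noteq> 0"
  have "\<exists>I\<in>X. \<exists>J\<in>X. K = I \<oplus>\<^sub>N J \<and> x I \<noteq> 0 \<and> y J \<noteq> 0"
  proof (rule ccontr)
    assume "\<not> ?thesis"
    then have "(x \<bullet>\<^sub>m y) K = 0"
      unfolding pf_mult_apply by (intro sum.neutral ballI) auto
    then show False using \<open>(x \<bullet>\<^sub>m y) K \<noteq> 0\<close> by simp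
  qed
  then obtain I J where IJ: "I \<in> X" "J \<in> X" "K = I \<oplus>\<^sub>N J" "x I \<noteq> 0" "y J \<noteq> 0" by blast
  then show "gr K = (d + d') mod N"
    using grade_nonzero[OF assms(1) IJ(4)] grade_nonzero[OF assms(2) IJ(5)]
    by (simp only: grade_add mod_add_eq)
qed

text \<open>The convex cone generated by the squares $\Theta(y)\otimes_t y$ of homogeneous $y$.
  Nonnegative real factors are not closure rules because $T(y,y)$ absorbs them.\<close>

inductive pf_positive :: "pf \<Rightarrow> bool" where
  zero: "pf_positive 0"
| square: "pf_has_grading N m d y \<Longrightarrow> pf_positive (T y y)"
| add: "pf_positive A \<Longrightarrow> pf_positive B \<Longrightarrow> pf_positive (A + B)"

lemma pf_positive_sum: "(\<And>a. a \<in> S \<Longrightarrow> pf_positive (f a)) \<Longrightarrow> pf_positive (\<Sum>a\<in>S. f a)"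
proof (induction S rule: infinite_finite_induct)
  case (insert a S)
  then show ?case by (subst sum.insert) (auto intro: pf_positive.intros)
next
  case (infinite S)
  then show ?case using pf_positive.zero by (subst sum.infinite)
next
  case empty
  then show ?case using pf_positive.zero by (subst sum.empty)
qed

text \<open>Bilinearity reduces this to two squares, whose product is again a square by multiplicativity of
  the twisted tensor product.\<close>

lemma pf_positive_mult:
  assumes "pf_positive A" "pf_positive B"
  shows "pf_positive (A \<bullet>\<^sub>2 B)"
  using assms(1)
proof (induction A rule: pf_positive.induct)
  case (square d y)
  show ?case using assms(2)
  proof (induction B rule: pf_positive.induct)
    case (square d' y')
    then show ?case using \<open>pf_has_grading N m d y\<close>
      by (simp only: twist_mult) (blast intro: pf_positive.square pf_has_grading_mult)
  qed (simp_all only: pf_mult_zero pf_mult_distrib pf_positive.intros)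
qed (simp_all only: pf_mult_zero pf_mult_distrib pf_positive.intros)

lemma twist_one: "T (pf_delta \<o>) (pf_delta \<o>) = pf_delta (replicate (2 * m) 0)"
  using twist_C[of \<o> \<o>] pf_index_zero[OF N0]
  by (simp add: pf_C_eq_delta N2) (simp add: twist_basis_def sum_list_replicate mult_2 replicate_add)

lemma pf_has_grading_one: "pf_has_grading N m 0 (pf_delta \<o>)"
  using pf_index_zero[OF N0]
  by (auto simp: pf_has_grading_def PF_carrier pf_delta_def sum_list_replicate)

lemma pf_positive_power:
  assumes "pf_positive A"
  shows "pf_positive (A [^]\<^bsub>PF N (2 * m)\<^esub> (k :: nat))"
proof (induction k)
  case 0
  have "pf_positive (pf_delta (replicate (2 * m) 0))"
    using pf_positive.square[OF pf_has_grading_one] by (simp only: twist_one)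
  then show ?case by (simp add: nat_pow_def PF_one)
next
  case (Suc k)
  then show ?case using assms pf_positive_mult by (simp add: nat_pow_def)
qed

text \<open>A square $T(y,y)$ contributes $|\mathrm{tr}(yx)|^2$.\<close>

lemma pf_positive_trace:
  assumes "pf_positive A"
  shows "pf_tr (2 * m) (A \<bullet>\<^sub>2 T x x) \<in> \<real>\<^sub>\<ge>\<^sub>0"
  using assms
proof (induction A rule: pf_positive.induct)
  case zero
  then show ?case by (simp only: pf_mult_zero) (simp add: pf_tr_def)
next
  case (square d y)
  have "cnj z * z \<in> \<real>\<^sub>\<ge>\<^sub>0" for z :: complex
    by (metis complex_norm_square mult.commute nonneg_Reals_of_real_iff zero_le_power2)
  then show ?case by (simp add: trace_twist_mult[OF square square])
next
  case (add A B)
  then show ?case by (simp only: pf_mult_distrib pf_tr_add nonneg_Reals_add_I)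
qed

lemma grading_combination:
  assumes "finite A" "\<And>a. a \<in> A \<Longrightarrow> f a \<in> X" "\<And>a. a \<in> A \<Longrightarrow> s a \<noteq> 0 \<Longrightarrow> gr (f a) = d mod N"
  shows "pf_has_grading N m d (\<Sum>a\<in>A. s a \<cdot>\<^sub>c pf_delta (f a))"
  unfolding pf_has_grading_def PF_carrier pf_sum_apply pf_scale_def pf_delta_def
proof (intro conjI allI impI)
  fix K assume "K \<notin> X"
  then show "(\<Sum>a\<in>A. s a * (if K = f a then 1 else 0)) = 0"
    using assms(2) by (intro sum.neutral) auto
next
  fix K assume "(\<Sum>a\<in>A. s a * (if K = f a then 1 else 0)) \<noteq> 0"
  then obtain a where "a \<in> A" "s a * (if K = f a then 1 else 0) \<noteq> 0"
    by (rule sum.not_neutral_contains_not_neutral)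
  then show "gr K = d mod N" using assms(3)[of a] by (auto split: if_splits)
qed

text \<open>Each rank one summand of $M$ is the matrix of a vector, whose homogeneous components are the
  elements \<open>y k d\<close>. Replacing the vector by its components only drops the entries between different
  gradings, and in the sum over all rank one summands those entries are zero.\<close>

lemma psd_matrix_positive:
  assumes S: "S \<subseteq> X" and psd: "psd_on S M"
    and bal: "\<And>I J. I \<in> S \<Longrightarrow> J \<in> S \<Longrightarrow> M I J \<noteq> 0 \<Longrightarrow> gr I = gr J"
  shows "pf_positive (\<Sum>I\<in>S. \<Sum>J\<in>S. M I J \<cdot>\<^sub>c twist_basis I J)"
proof -
  have fin: "finite S" using S finite_pf_index by (rule finite_subset)
  obtain v where v: "\<And>I J. I \<in> S \<Longrightarrow> J \<in> S \<Longrightarrow> M I J = (\<Sum>k\<in>S. cnj (v k I) * v k J)"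
    using psd_on_sum_of_squares[OF fin psd] by blast
  let ?c = "\<lambda>k d I. if gr I = d then v k I else 0"
  define y where "y k d = (\<Sum>I\<in>S. ?c k d I \<cdot>\<^sub>c pf_delta I)" for k d
  have "pf_has_grading N m d (y k d)" if "d < N" for k d
    unfolding y_def by (rule grading_combination) (use fin S that in \<open>auto split: if_splits\<close>)
  then have "pf_positive (\<Sum>k\<in>S. \<Sum>d<N. T (y k d) (y k d))"
    by (intro pf_positive_sum) (auto intro: pf_positive.square)
  also have "(\<Sum>k\<in>S. \<Sum>d<N. T (y k d) (y k d)) =
      (\<Sum>k\<in>S. \<Sum>d<N. \<Sum>I\<in>S. \<Sum>J\<in>S. (cnj (?c k d I) * ?c k d J) \<cdot>\<^sub>c twist_basis I J)"
    unfolding y_def by (intro sum.cong refl twist_combination) (use fin S in auto)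
  also have "\<dots> = (\<Sum>I\<in>S. \<Sum>J\<in>S. \<Sum>k\<in>S. \<Sum>d<N. (cnj (?c k d I) * ?c k d J) \<cdot>\<^sub>c twist_basis I J)"
    by (rule sum_swap_pairs)
  also have "\<dots> = (\<Sum>I\<in>S. \<Sum>J\<in>S. (\<Sum>k\<in>S. \<Sum>d<N. cnj (?c k d I) * ?c k d J) \<cdot>\<^sub>c twist_basis I J)"
    by (simp only: pf_sum_scale)
  also have "\<dots> = (\<Sum>I\<in>S. \<Sum>J\<in>S. M I J \<cdot>\<^sub>c twist_basis I J)"
  proof (intro sum.cong refl)
    fix I J assume IJ: "I \<in> S" "J \<in> S"
    have inner: "(\<Sum>d<N. cnj (?c k d I) * ?c k d J) = (if gr I = gr J then cnj (v k I) * v k J else 0)" for k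
    proof -
      have "(\<Sum>d<N. cnj (?c k d I) * ?c k d J) =
          (\<Sum>d<N. if d = gr I then if gr I = gr J then cnj (v k I) * v k J else 0 else 0)"
        by (intro sum.cong) auto
      then show ?thesis using N0 by simp
    qed
    have "(\<Sum>k\<in>S. \<Sum>d<N. cnj (?c k d I) * ?c k d J) = (if gr I = gr J then M I J else 0)"
      unfolding inner v[OF IJ] by (cases "gr I = gr J") simp_all
    also have "\<dots> = M I J" using bal[OF IJ] by auto
    finally show "(\<Sum>k\<in>S. \<Sum>d<N. cnj (?c k d I) * ?c k d J) \<cdot>\<^sub>c twist_basis I J =
        M I J \<cdot>\<^sub>c twist_basis I J" by (simp only:)
  qed
  finally show ?thesis .
qed

lemma pf_positive_closed: "pf_positive A \<Longrightarrow> A \<in> carrier (PF N (2 * m))"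
proof (induction A rule: pf_positive.induct)
  case zero
  show ?case by (simp add: PF_carrier)
next
  case (square d y)
  show ?case by (rule twist_closed)
next
  case (add A B)
  then show ?case by (intro pf_add_closed)
qed

lemma trace_exp_positive:
  assumes "pf_positive A" "\<beta> \<ge> 0"
  shows "pf_tr (2 * m) (pf_exp N (2 * m) (of_real \<beta> \<cdot>\<^sub>c A) \<bullet>\<^sub>2 T x x) \<in> \<real>\<^sub>\<ge>\<^sub>0"
proof (rule nonneg_Reals_sums)
  show "(\<lambda>k. pf_tr (2 * m) (pf_pow N (2 * m) (of_real \<beta> \<cdot>\<^sub>c A) k \<bullet>\<^sub>2 T x x) / fact k) sums
    pf_tr (2 * m) (pf_exp N (2 * m) (of_real \<beta> \<cdot>\<^sub>c A) \<bullet>\<^sub>2 T x x)"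
    by (intro trace_exp_sums N0 pf_scale_closed pf_positive_closed assms)
  fix k
  have "(fact k :: complex) = of_real (fact k)" by simp
  then show "pf_tr (2 * m) (pf_pow N (2 * m) (of_real \<beta> \<cdot>\<^sub>c A) k \<bullet>\<^sub>2 T x x) / fact k \<in> \<real>\<^sub>\<ge>\<^sub>0"
    unfolding pf_pow_scale pf_mult_scale pf_tr_scale using assms
    by (auto intro!: nonneg_Reals_divide_I nonneg_Reals_mult_I nonneg_Reals_pow_I
        pf_positive_trace pf_positive_power simp flip: of_real_power simp del: of_real_fact)
qed

section \<open>Reflection positivity and the coupling matrix\<close>

text \<open>Distinct pairs $(I,J)$ give multiples of distinct basis elements of $PF_{2m}$, so the matrix can be
  read off from the coefficients.\<close>

lemma twist_matrix_coeff:
  assumes "K \<in> X" "L \<in> X"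
  shows "(\<Sum>I\<in>X. \<Sum>J\<in>X. M I J \<cdot>\<^sub>c twist_basis I J) (pf_reflect N K @ L) =
    M K L * (\<zeta> ^ (gr K * gr L) * ph K K)"
proof -
  have "(M I J \<cdot>\<^sub>c twist_basis I J) (pf_reflect N K @ L) =
      (if I = K then if J = L then M K L * (\<zeta> ^ (gr K * gr L) * ph K K) else 0 else 0)"
    if "I \<in> X" "J \<in> X" for I J
    using that assms
    by (auto simp: pf_scale_def twist_basis_def pf_delta_def append_eq_append_conv pf_index_length
        pf_reflect_inj[where n = m])
  then have "(\<Sum>I\<in>X. \<Sum>J\<in>X. M I J \<cdot>\<^sub>c twist_basis I J) (pf_reflect N K @ L) =
     (\<Sum>I\<in>X. \<Sum>J\<in>X. if I = K then if J = L then M K L * (\<zeta> ^ (gr K * gr L) * ph K K) else 0 else 0)"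
    unfolding pf_sum_apply by (intro sum.cong refl) blast
  also have "\<dots> = (\<Sum>I\<in>X. if I = K then \<Sum>J\<in>X. if J = L then M K L * (\<zeta> ^ (gr K * gr L) * ph K K) else 0 else 0)"
    by (intro sum.cong) auto
  finally show ?thesis using assms by simp
qed

lemma zeta_nz: "\<zeta> \<noteq> 0"
  using zeta_sq pf_q_nz[of N] by auto

text \<open>$\Theta(C_I)\otimes_t C_J$ has grading $|J|-|I|$.\<close>

lemma neutral_matrix:
  assumes H: "- H = (\<Sum>I\<in>X. \<Sum>J\<in>X. M I J \<cdot>\<^sub>c twist_basis I J)"
    and g: "pf_has_grading N (2 * m) 0 H" and X: "I \<in> X" "J \<in> X" and nz: "M I J \<noteq> 0"
  shows "gr I = gr J"
proof -
  have "(- H) (pf_reflect N I @ J) \<noteq> 0"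
    unfolding H twist_matrix_coeff[OF X] using nz zeta_nz by simp
  then have "H (pf_reflect N I @ J) \<noteq> 0" by simp
  then have "N dvd sum_list (pf_reflect N I) + sum_list J"
    using g by (auto simp: pf_has_grading_def)
  moreover have "N dvd sum_list (pf_reflect N I) + sum_list I"
    using X by (intro pf_grade_reflect) (auto simp: pf_index_def)
  ultimately have "(sum_list (pf_reflect N I) mod N + gr I) mod N =
      (sum_list (pf_reflect N I) mod N + gr J) mod N"
    by (simp only: mod_add_eq dvd_eq_mod_eq_0)
  then show ?thesis by (rule mod_add_cancel) (simp_all add: N0)
qed

text \<open>Comparing $\Theta(H)$ with $H$ at $\Theta(C_I)\in A_-$, the reflection of $\sigma(C_I)\in A_+$,
  gives the Hermitian symmetry of the row and column of the empty index. For the remaining entries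
  the symmetry is a consequence of positive semi-definiteness.\<close>

lemma hermitian_matrix_border:
  assumes H: "- H = (\<Sum>I\<in>X. \<Sum>J\<in>X. M I J \<cdot>\<^sub>c twist_basis I J)"
    and \<theta>: "pf_Theta N (2 * m) H = H" and I: "I \<in> X"
  shows "M I \<o> = cnj (M \<o> I)"
proof -
  have o: "\<o> \<in> X" by (rule pf_index_zero[OF N0])
  let ?Y = "pf_index N (2 * m)"
  have oI: "\<o> @ I \<in> ?Y" using o I by (rule pf_index_append)
  have r: "pf_reflect N (\<o> @ I) = pf_reflect N I @ \<o>" by (simp add: pf_reflect_append)
  have "pf_Theta N (2 * m) H (pf_reflect N (\<o> @ I)) =
      (\<Sum>K\<in>?Y. if K = \<o> @ I then cnj (H (\<o> @ I)) * ph (\<o> @ I) (\<o> @ I) else 0)"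
    unfolding pf_Theta_def pf_sum_apply
  proof (intro sum.cong refl)
    fix K assume K: "K \<in> ?Y"
    show "(cnj (H K) \<cdot>\<^sub>c pf_Theta_C N (2 * m) K) (pf_reflect N (\<o> @ I)) =
      (if K = \<o> @ I then cnj (H (\<o> @ I)) * ph (\<o> @ I) (\<o> @ I) else 0)"
      using pf_reflect_inj[OF oI K] by (auto simp: pf_Theta_C_eq[OF N2 K] pf_scale_def pf_delta_def)
  qed
  also have "\<dots> = cnj (H (\<o> @ I)) * ph I I"
    using oI by (simp add: pf_phase_append sum_list_replicate)
  finally have 1: "(- H) (pf_reflect N I @ \<o>) = cnj ((- H) (\<o> @ I)) * ph I I"
    unfolding \<theta> r by simp
  have "(- H) (pf_reflect N I @ \<o>) = M I \<o> * ph I I"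
    unfolding H twist_matrix_coeff[OF I o] by (simp add: sum_list_replicate)
  moreover have "(- H) (\<o> @ I) = M \<o> I"
    using twist_matrix_coeff[OF o I, of M] unfolding H by (simp add: sum_list_replicate)
  ultimately have "M I \<o> * ph I I = cnj (M \<o> I) * ph I I" using 1 by (simp only:)
  then show ?thesis by simp
qed

theorem reflection_positive_if_psd:
  assumes G: "G = (\<Sum>I\<in>X. \<Sum>J\<in>X. M I J \<cdot>\<^sub>c twist_basis I J)"
    and bal: "\<And>I J. I \<in> X \<Longrightarrow> J \<in> X \<Longrightarrow> M I J \<noteq> 0 \<Longrightarrow> gr I = gr J"
    and herm: "\<And>I. I \<in> X \<Longrightarrow> M I \<o> = cnj (M \<o> I)"
    and psd: "psd_on (X - {\<o>}) M" and \<beta>: "\<beta> \<ge> 0"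
  shows "pf_tr (2 * m) (pf_exp N (2 * m) (of_real \<beta> \<cdot>\<^sub>c G) \<bullet>\<^sub>2 T x x) \<in> \<real>\<^sub>\<ge>\<^sub>0"
proof -
  let ?S = "X - {\<o>}" and ?one = "pf_delta \<o>" and ?One = "pf_delta (replicate (2 * m) 0)"
  have o: "\<o> \<in> X" by (rule pf_index_zero[OF N0])
  define \<kappa> where "\<kappa> = (\<Sum>I\<in>?S. M \<o> I \<cdot>\<^sub>c pf_delta I)"
  \<comment> \<open>The two borders of the matrix are $T(1,\kappa)$ and $T(\kappa,1)$, the interior is \<open>P\<close>.\<close>
  define P where "P = (\<Sum>I\<in>?S. \<Sum>J\<in>?S. M I J \<cdot>\<^sub>c twist_basis I J)"
  have P: "pf_positive P"
    unfolding P_def using bal by (intro psd_matrix_positive psd) auto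
  have g\<kappa>: "pf_has_grading N m 0 \<kappa>"
    unfolding \<kappa>_def using bal[OF o] by (intro grading_combination) (auto simp: sum_list_replicate)
  have T1: "T ?one \<kappa> = (\<Sum>J\<in>?S. M \<o> J \<cdot>\<^sub>c twist_basis \<o> J)"
    using twist_combination[of "{()}" "\<lambda>_. \<o>" ?S "\<lambda>I. I" "\<lambda>_. 1" "M \<o>"] o by (simp add: \<kappa>_def)
  have T2: "T \<kappa> ?one = (\<Sum>I\<in>?S. M I \<o> \<cdot>\<^sub>c twist_basis I \<o>)"
    using twist_combination[of ?S "\<lambda>I. I" "{()}" "\<lambda>_. \<o>" "M \<o>" "\<lambda>_. 1"] o by (simp add: \<kappa>_def herm)
  have T0: "twist_basis \<o> \<o> = ?One"
    using twist_C[OF o o] by (simp only: pf_C_eq_delta[OF N2 o] twist_one)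
  have split: "sum f X = f \<o> + sum f ?S" for f :: "nat list \<Rightarrow> pf"
    by (rule sum.remove) (use o in auto)
  have Gs: "G = M \<o> \<o> \<cdot>\<^sub>c ?One + T ?one \<kappa> + (T \<kappa> ?one + P)"
    unfolding G split P_def T1 T2 T0 sum.distrib by (simp only: ac_simps)
  define \<mu> where "\<mu> = Re (M \<o> \<o>)"
  have \<mu>: "M \<o> \<o> = of_real \<mu>"
    using herm[OF o] by (simp add: \<mu>_def complex_eq_iff)
  \<comment> \<open>The coefficients $s$ and $s^{-1}$ make the cross terms of $T(w,w)$ equal to the borders, while the
    unwanted term $T(\kappa,\kappa)$ carries the factor $s^{-2}$.\<close>
  define w where "w s = of_real s \<cdot>\<^sub>c ?one + of_real (inverse s) \<cdot>\<^sub>c \<kappa>" for s :: real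
  have gw: "pf_has_grading N m 0 (w s)" for s
    using pf_has_grading_one g\<kappa>
    unfolding w_def pf_has_grading_def PF_carrier pf_scale_def plus_fun_apply
    by (metis add_0 mult_zero_right)
  have Tw: "T (w s) (w s) = of_real (s * s) \<cdot>\<^sub>c ?One + T ?one \<kappa> + (T \<kappa> ?one +
      of_real (inverse s * inverse s) \<cdot>\<^sub>c T \<kappa> \<kappa>)" if "s > 0" for s
    using that unfolding w_def by (simp add: twist_add twist_scale twist_one)
  have key: "G + of_real (inverse s * inverse s) \<cdot>\<^sub>c T \<kappa> \<kappa> =
      (T (w s) (w s) + P) + of_real (\<mu> - s * s) \<cdot>\<^sub>c ?One" if "s > 0" for s
    unfolding Gs Tw[OF that] \<mu>
    by (simp add: fun_eq_iff pf_scale_def algebra_simps)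
  have nonneg: "pf_tr (2 * m) (pf_exp N (2 * m)
      (of_real \<beta> \<cdot>\<^sub>c (G + of_real (inverse s * inverse s) \<cdot>\<^sub>c T \<kappa> \<kappa>)) \<bullet>\<^sub>2 T x x) \<in> \<real>\<^sub>\<ge>\<^sub>0" if "s > 0" for s
  proof -
    have pos: "pf_positive (T (w s) (w s) + P)"
      by (intro pf_positive.add pf_positive.square[OF gw] P)
    have "exp (of_real \<beta> * of_real (\<mu> - s * s)) = complex_of_real (exp (\<beta> * (\<mu> - s * s)))"
      by (simp only: exp_of_real flip: of_real_mult)
    then have "exp (of_real \<beta> * complex_of_real (\<mu> - s * s)) \<in> \<real>\<^sub>\<ge>\<^sub>0"
      by (simp only: nonneg_Reals_of_real_iff exp_ge_zero)
    then show ?thesis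
      unfolding key[OF that] pf_scale_add[of "of_real \<beta>" "T (w s) (w s) + P"] pf_scale_scale
        trace_exp_shift[OF N0 pf_scale_closed[OF pf_positive_closed[OF pos]]]
      by (intro nonneg_Reals_mult_I trace_exp_positive pos \<beta>)
  qed
  let ?r = "\<lambda>i. inverse (real (Suc i)) * inverse (real (Suc i))"
  have "(\<lambda>i. complex_of_real (?r i)) \<longlonglongrightarrow> of_real (0 * 0)"
    by (intro tendsto_of_real tendsto_mult LIMSEQ_inverse_real_of_nat)
  then have r0: "(\<lambda>i. complex_of_real (?r i)) \<longlonglongrightarrow> 0" by simp
  have r1: "norm (complex_of_real (?r i)) \<le> 1" for i
  proof -
    have "inverse (real (Suc i)) \<le> 1" by (simp add: inverse_le_1_iff)
    then have "?r i \<le> 1 * 1" by (intro mult_mono) auto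
    then show ?thesis unfolding norm_of_real by (simp del: of_nat_Suc)
  qed
  have "(\<lambda>i. pf_tr (2 * m) (pf_exp N (2 * m) (of_real \<beta> \<cdot>\<^sub>c G +
      of_real (?r i) \<cdot>\<^sub>c (of_real \<beta> \<cdot>\<^sub>c T \<kappa> \<kappa>)) \<bullet>\<^sub>2 T x x)) \<longlonglongrightarrow>
    pf_tr (2 * m) (pf_exp N (2 * m) (of_real \<beta> \<cdot>\<^sub>c G) \<bullet>\<^sub>2 T x x)"
  proof (intro trace_exp_tendsto N0 pf_scale_closed twist_closed r0 r1)
    show "G \<in> carrier (PF N (2 * m))"
      unfolding Gs
      by (intro pf_add_closed pf_scale_closed twist_closed pf_one_closed N0 pf_positive_closed P)
  qed
  moreover have "of_real \<beta> \<cdot>\<^sub>c G + of_real (?r i) \<cdot>\<^sub>c (of_real \<beta> \<cdot>\<^sub>c T \<kappa> \<kappa>) =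
      of_real \<beta> \<cdot>\<^sub>c (G + of_real (?r i) \<cdot>\<^sub>c T \<kappa> \<kappa>)" for i
    by (simp only: pf_scale_add pf_scale_scale mult.commute)
  ultimately have lim: "(\<lambda>i. pf_tr (2 * m) (pf_exp N (2 * m)
      (of_real \<beta> \<cdot>\<^sub>c (G + of_real (?r i) \<cdot>\<^sub>c T \<kappa> \<kappa>)) \<bullet>\<^sub>2 T x x)) \<longlonglongrightarrow>
    pf_tr (2 * m) (pf_exp N (2 * m) (of_real \<beta> \<cdot>\<^sub>c G) \<bullet>\<^sub>2 T x x)"
    by (simp only:)
  show ?thesis
    by (rule closed_sequentially[OF closed_nonneg_Reals_complex _ lim]) (intro nonneg, simp)
qed

theorem psd_if_reflection_positive:
  assumes G: "G = (\<Sum>I\<in>X. \<Sum>J\<in>X. M I J \<cdot>\<^sub>c twist_basis I J)"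
    and bal: "\<And>I J. I \<in> X \<Longrightarrow> J \<in> X \<Longrightarrow> M I J \<noteq> 0 \<Longrightarrow> gr I = gr J"
    and pos: "\<And>x \<beta>. x \<in> carrier (PF N m) \<Longrightarrow> \<beta> \<ge> 0 \<Longrightarrow>
      pf_tr (2 * m) (pf_exp N (2 * m) (of_real \<beta> \<cdot>\<^sub>c G) \<bullet>\<^sub>2 T x x) \<in> \<real>\<^sub>\<ge>\<^sub>0"
  shows "psd_on (X - {\<o>}) M"
  unfolding psd_on_def
proof
  fix v :: "nat list \<Rightarrow> complex"
  have o: "\<o> \<in> X" by (rule pf_index_zero[OF N0])
  define neg where "neg I = map (\<lambda>i. (N - i) mod N) I" for I
  have neg_X: "neg I \<in> X" if "I \<in> X" for I
    using that N0 by (auto simp: neg_def pf_index_def)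
  have neg_neg: "neg (neg I) = I" if "I \<in> X" for I
    using that by (auto simp: neg_def pf_index_def pf_neg_neg subset_iff intro!: map_idI)
  have add_neg: "I \<oplus>\<^sub>N K = \<o> \<longleftrightarrow> K = neg I" if "I \<in> X" "K \<in> X" for I K
    unfolding neg_def by (rule pf_index_add_eq_zero[OF that])
  define u where "u I = (if I = \<o> then 0 else v I)" for I
  \<comment> \<open>The coefficient of $C_{-I}$ in \<open>x\<close> is the only one contributing to $\mathrm{tr}(C_Ix)$; dividing by
    the reordering phase makes this trace equal to \<open>u I\<close>.\<close>
  define x where "x K = (if K \<in> X then u (neg K) / ph (neg K) K else 0)" for K
  have x: "x \<in> carrier (PF N m)" by (simp add: x_def PF_carrier)
  have tr: "pf_tr m (pf_delta I \<bullet>\<^sub>m x) = u I" if I: "I \<in> X" for I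
  proof -
    have "pf_tr m (pf_delta I \<bullet>\<^sub>m x) = (\<Sum>K\<in>X. if K = neg I then u I else 0)"
      unfolding pf_tr_def pf_delta_mult_left[OF I]
    proof (intro sum.cong refl)
      fix K assume "K \<in> X"
      then show "(if \<o> = I \<oplus>\<^sub>N K then x K * ph I K else 0) = (if K = neg I then u I else 0)"
        using add_neg[OF I, of K] neg_neg[OF I] by (auto simp: x_def eq_commute[of \<o>])
    qed
    then show ?thesis using neg_X[OF I] by simp
  qed
  have "pf_tr (2 * m) (T x x) = pf_tr (2 * m) (T (pf_delta \<o>) (pf_delta \<o>) \<bullet>\<^sub>2 T x x)"
    unfolding twist_one by (simp only: pf_mult_one(1)[OF N0 twist_closed])
  also have "\<dots> = 0"
    unfolding trace_twist_mult[OF pf_has_grading_one pf_has_grading_one] tr[OF o] by (simp add: u_def)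
  finally have tr0: "pf_tr (2 * m) (T x x) = 0" .
  have "pf_tr (2 * m) (G \<bullet>\<^sub>2 T x x) \<in> \<real>\<^sub>\<ge>\<^sub>0"
  proof (rule trace_exp_first_order[OF N0 _ twist_closed tr0 pos[OF x]])
    show "G \<in> carrier (PF N (2 * m))" unfolding G using twist_basis_closed
      by (auto simp: PF_carrier pf_sum_apply pf_scale_def intro!: sum.neutral)
  qed
  also have "pf_tr (2 * m) (G \<bullet>\<^sub>2 T x x) =
      (\<Sum>I\<in>X. \<Sum>J\<in>X. M I J * pf_tr (2 * m) (twist_basis I J \<bullet>\<^sub>2 T x x))"
    by (simp only: G pf_mult_sum_left pf_mult_scale pf_tr_sum pf_tr_scale)
  also have "\<dots> = (\<Sum>I\<in>X. \<Sum>J\<in>X. cnj (u I) * M I J * u J)"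
  proof (intro sum.cong refl)
    fix I J assume IJ: "I \<in> X" "J \<in> X"
    show "M I J * pf_tr (2 * m) (twist_basis I J \<bullet>\<^sub>2 T x x) = cnj (u I) * M I J * u J"
    proof (cases "M I J = 0")
      case False
      have h: "pf_has_grading N m (gr I) (pf_delta K)" if "K \<in> X" "gr K = gr I" for K
        using that by (auto simp: pf_has_grading_def PF_carrier pf_delta_def)
      have e: "twist_basis I J = T (pf_delta I) (pf_delta J)"
        using twist_C[OF IJ] by (simp only: pf_C_eq_delta[OF N2 IJ(1)] pf_C_eq_delta[OF N2 IJ(2)])
      have "pf_tr (2 * m) (twist_basis I J \<bullet>\<^sub>2 T x x) = cnj (u I) * u J"
        unfolding e trace_twist_mult[OF h[OF IJ(1) refl] h[OF IJ(2) bal[OF IJ False, symmetric]]]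
          tr[OF IJ(1)] tr[OF IJ(2)] by (rule refl)
      then show ?thesis by simp
    qed simp
  qed
  also have "\<dots> = (\<Sum>I\<in>X - {\<o>}. \<Sum>J\<in>X. cnj (u I) * M I J * u J)"
    by (intro sum.mono_neutral_right) (auto simp: u_def)
  also have "\<dots> = (\<Sum>I\<in>X - {\<o>}. \<Sum>J\<in>X - {\<o>}. cnj (v I) * M I J * v J)"
    by (intro sum.cong refl sum.mono_neutral_cong_right) (auto simp: u_def)
  finally show "(\<Sum>I\<in>X - {\<o>}. \<Sum>J\<in>X - {\<o>}. cnj (v I) * M I J * v J) \<in> \<real>\<^sub>\<ge>\<^sub>0" .
qed

end

theorem theorem7p4:
  fixes N m :: nat and \<zeta> :: complex and H :: pf and J :: "nat list \<Rightarrow> nat list \<Rightarrow> complex"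
  assumes "N \<ge> 2" and "m \<ge> 1"
    and "\<zeta>\<^sup>2 = pf_q N" and "\<zeta> ^ (N\<^sup>2) = 1"
    and "H \<in> carrier (PF N (2 * m))"
    and "- H = (\<Sum>I\<in>pf_index N m. \<Sum>I'\<in>pf_index N m.
           J I I' \<cdot>\<^sub>c pf_Theta_twist \<zeta> N m (pf_C N m I) (pf_C N m I'))"
    and "pf_Theta N (2 * m) H = H"
    and "pf_has_grading N (2 * m) 0 H"
  shows "pf_reflection_positive \<zeta> N m H \<longleftrightarrow>
    psd_on (pf_index N m - {replicate m 0}) J"
proof -
  interpret parafermion_double N m \<zeta>
    using assms(1,3,4) by unfold_locales
  have G: "- H = (\<Sum>I\<in>X. \<Sum>I'\<in>X. J I I' \<cdot>\<^sub>c twist_basis I I')"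
    unfolding assms(6) by (intro sum.cong refl) (simp only: twist_C)
  have bal: "gr I = gr I'" if "I \<in> X" "I' \<in> X" "J I I' \<noteq> 0" for I I'
    by (rule neutral_matrix[OF G assms(8) that])
  have sign: "of_real (- \<beta>) \<cdot>\<^sub>c H = of_real \<beta> \<cdot>\<^sub>c (- H)" for \<beta> :: real
    by (simp add: fun_eq_iff pf_scale_def)
  show ?thesis
    unfolding pf_reflection_positive_def PF_mult sign
  proof
    assume "\<forall>x\<in>carrier (PF N m). \<forall>\<beta>\<ge>0. pf_tr (2 * m)
      (pf_exp N (2 * m) (of_real \<beta> \<cdot>\<^sub>c (- H)) \<bullet>\<^sub>2 T x x) \<in> \<real>\<^sub>\<ge>\<^sub>0"
    then show "psd_on (X - {\<o>}) J"
      by (intro psd_if_reflection_positive[OF G bal]) auto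
  next
    assume "psd_on (X - {\<o>}) J"
    then show "\<forall>x\<in>carrier (PF N m). \<forall>\<beta>\<ge>0. pf_tr (2 * m)
      (pf_exp N (2 * m) (of_real \<beta> \<cdot>\<^sub>c (- H)) \<bullet>\<^sub>2 T x x) \<in> \<real>\<^sub>\<ge>\<^sub>0"
      by (intro ballI allI impI
          reflection_positive_if_psd[OF G bal hermitian_matrix_border[OF G assms(7)]])
  qed
qed

end
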